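(* Let $G$ be a Young function satisfying (growth) and let $M$ and $N$ satisfy (M1), (M2) and (M3). Then $C_c^\infty(\mathbb{R}^n)$ is dense in $W^{M,N,G}(\mathbb{R}^n)$ with respect to the norm $\|\cdot\|_{M,N,G}$.
   Context: A Young function is a function $G:\mathbb{R}\to\mathbb{R}$ that is even, continuous, convex, increasing for $t>0$, with $G(0)=0$, $\lim_{x\to 0}G(x)/x=0$ and $\lim_{x\to\infty}G(x)/x=\infty$. Write $g=G'$. It is normalized by $G(1)=1$. (growth): there are constants $p^-,p^+$ with $1<p^-\le \frac{t g(t)}{G(t)}\le p^+$ for all $t>0$. $M,N:\mathbb{R}_+\to\mathbb{R}_+$ (with $\mathbb{R}_+=[0,\infty)$) satisfy: (M1) $M$ and $N$ are nondecreasing and $M(r),N(r)>0$ for $r>0$; (M2) $M(r)\ge\min\{1,r\}$ and $N$ is continuous; (M3) $\int_0^1 \frac{r^{n-1+p^-}}{N(r)M(r)^{p^-}}\,dr<\infty$ and $\int_1^\infty \frac{r^{n-1}}{N(r)M(r)^{p^-}}\,dr<\infty$. Modulars: $\Phi_G(u)=\int_{\mathbb{R}^n}G(u(x))\,dx$ and $\Phi_{M,N,G}(u)=\int_{\mathbb{R}^{2n}}G\left(\frac{u(x)-u(y)}{M(|x-y|)}\right)\frac{dx\,dy}{N(|x-y|)}$. Spaces: $L^G(\mathbb{R}^n)=\{u:\mathbb{R}^n\to\mathbb{R}\text{ measurable}: \Phi_G(u)<\infty\}$ and $W^{M,N,G}(\mathbb{R}^n)=\{u\in L^G(\mathbb{R}^n):\Phi_{M,N,G}(u)<\infty\}$.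 Luxemburg norms: $\|u\|_G=\inf\{\lambda>0:\Phi_G(u/\lambda)\le1\}$, $[u]_{M,N,G}=\inf\{\lambda>0:\Phi_{M,N,G}(u/\lambda)\le1\}$, $\|u\|_{M,N,G}=\|u\|_G+[u]_{M,N,G}$. *)

theory Defs
  imports "HOL-Analysis.Analysis"
begin

text \<open>Young functions, with the normalization \<open>G 1 = 1\<close> built in.\<close>

definition young_function :: "(real \<Rightarrow> real) \<Rightarrow> bool" where
  "young_function G \<longleftrightarrow>
     (\<forall>t. G (- t) = G t) \<and> continuous_on UNIV G \<and> convex_on UNIV G \<and>
     strict_mono_on {0<..} G \<and> G 0 = 0 \<and>
     ((\<lambda>x. G x / x) \<longlongrightarrow> 0) (at 0) \<and>
     filterlim (\<lambda>x. G x / x) at_top at_top \<and>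
     G 1 = 1"

text \<open>The existence of \<open>g = G'\<close> on \<open>(0, \<infinity>)\<close> is part of the growth condition: \<open>deriv\<close> has no
  specified value where the derivative does not exist.\<close>

definition growth :: "real \<Rightarrow> real \<Rightarrow> (real \<Rightarrow> real) \<Rightarrow> bool" where
  "growth p q G \<longleftrightarrow> 1 < p \<and>
     (\<forall>t>0. G field_differentiable (at t) \<and>
            p \<le> t * deriv G t / G t \<and> t * deriv G t / G t \<le> q)"

text \<open>In the following conditions only the values of \<open>M\<close> and \<open>N\<close> on \<open>[0, \<infinity>)\<close> matter.\<close>

definition cond_M1 :: "(real \<Rightarrow> real) \<Rightarrow> (real \<Rightarrow> real) \<Rightarrow> bool" where
  "cond_M1 M N \<longleftrightarrow> mono_on {0..} M \<and> mono_on {0..} N \<and> (\<forall>r>0. M r > 0 \<and> N r > 0)"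

definition cond_M2 :: "(real \<Rightarrow> real) \<Rightarrow> (real \<Rightarrow> real) \<Rightarrow> bool" where
  "cond_M2 M N \<longleftrightarrow> (\<forall>r\<ge>0. M r \<ge> min 1 r) \<and> continuous_on {0..} N"

definition cond_M3 :: "nat \<Rightarrow> real \<Rightarrow> (real \<Rightarrow> real) \<Rightarrow> (real \<Rightarrow> real) \<Rightarrow> bool" where
  "cond_M3 n p M N \<longleftrightarrow>
     (\<integral>\<^sup>+r\<in>{0..1}. ennreal (r powr (real n - 1 + p) / (N r * M r powr p)) \<partial>lborel) < \<infinity> \<and>
     (\<integral>\<^sup>+r\<in>{1..}. ennreal (r powr (real n - 1) / (N r * M r powr p)) \<partial>lborel) < \<infinity>"

definition modular_G :: "(real \<Rightarrow> real) \<Rightarrow> (real ^ 'n \<Rightarrow> real) \<Rightarrow> ennreal" where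
  "modular_G G u = (\<integral>\<^sup>+x. ennreal (G (u x)) \<partial>lebesgue)"

definition modular_MNG ::
  "(real \<Rightarrow> real) \<Rightarrow> (real \<Rightarrow> real) \<Rightarrow> (real \<Rightarrow> real) \<Rightarrow> (real ^ 'n \<Rightarrow> real) \<Rightarrow> ennreal" where
  "modular_MNG M N G u =
     (\<integral>\<^sup>+(x, y). ennreal (G ((u x - u y) / M (norm (x - y))) / N (norm (x - y)))
        \<partial>(lebesgue :: ((real ^ 'n) \<times> (real ^ 'n)) measure))"

definition L_space :: "(real \<Rightarrow> real) \<Rightarrow> (real ^ 'n \<Rightarrow> real) set" where
  "L_space G = {u \<in> borel_measurable lebesgue. modular_G G u < \<infinity>}"

definition W_space ::
  "(real \<Rightarrow> real) \<Rightarrow> (real \<Rightarrow> real) \<Rightarrow> (real \<Rightarrow> real) \<Rightarrow> (real ^ 'n \<Rightarrow> real) set" where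
  "W_space M N G = {u \<in> L_space G. modular_MNG M N G u < \<infinity>}"

text \<open>The infima are taken in the reals. For a function with finite modulars the sets involved are
  nonempty, since convexity and \<open>G 0 = 0\<close> give \<open>G (t / c) \<le> G t / c\<close> for \<open>c \<ge> 1\<close>.\<close>

definition norm_G :: "(real \<Rightarrow> real) \<Rightarrow> (real ^ 'n \<Rightarrow> real) \<Rightarrow> real" where
  "norm_G G u = Inf {c. 0 < c \<and> modular_G G (\<lambda>x. u x / c) \<le> 1}"

definition seminorm_MNG ::
  "(real \<Rightarrow> real) \<Rightarrow> (real \<Rightarrow> real) \<Rightarrow> (real \<Rightarrow> real) \<Rightarrow> (real ^ 'n \<Rightarrow> real) \<Rightarrow> real" where
  "seminorm_MNG M N G u = Inf {c. 0 < c \<and> modular_MNG M N G (\<lambda>x. u x / c) \<le> 1}"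

definition norm_MNG ::
  "(real \<Rightarrow> real) \<Rightarrow> (real \<Rightarrow> real) \<Rightarrow> (real \<Rightarrow> real) \<Rightarrow> (real ^ 'n \<Rightarrow> real) \<Rightarrow> real" where
  "norm_MNG M N G u = norm_G G u + seminorm_MNG M N G u"

text \<open>\<open>C_k k f\<close>: \<open>f\<close> is \<open>k\<close> times continuously differentiable. Requiring total differentiability
  at each step costs nothing, because continuous partial derivatives imply it.\<close>

fun C_k :: "nat \<Rightarrow> (real ^ 'n \<Rightarrow> real) \<Rightarrow> bool" where
  "C_k 0 f \<longleftrightarrow> continuous_on UNIV f"
| "C_k (Suc k) f \<longleftrightarrow> f differentiable_on UNIV \<and>
     (\<forall>i. C_k k (\<lambda>x. frechet_derivative f (at x) (axis i 1)))"

definition Cc_infinity :: "(real ^ 'n \<Rightarrow> real) set" where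
  "Cc_infinity = {f. (\<forall>k. C_k k f) \<and> compact (closure {x. f x \<noteq> 0})}"

end

theory Submission
  imports Defs "HOL-Probability.Probability_Measure"
begin

text \<open>
  The growth condition gives \<open>G (s t) \<le> s\<^sup>p G t\<close> for \<open>s \<le> 1\<close> and \<open>G (s t) \<le> s\<^sup>q G t\<close> for \<open>s \<ge> 1\<close>. The
  second estimate makes \<open>G\<close> satisfy the doubling condition, so that \<open>G (a + b) \<le> \<Delta> (G a + G b)\<close> and
  smallness of the modulars implies smallness of the Luxemburg norms; hence everything can be done
  with modulars. The first one, with the factor \<open>s = min 1 |h| / M |h|\<close> (at most one by (M2)), makes (M3)
  usable: in polar coordinates it says precisely that \<open>(min 1 |h| / M |h|)\<^sup>p / N |h|\<close> is integrable.

  With \<open>y = x + h\<close> the double integral becomes an integral over \<open>h\<close>, with weight \<open>1 / N |h|\<close>, of the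
  \<open>G\<close>-modular of the difference quotient \<open>x \<mapsto> (u x - u (x + h)) / M |h|\<close> (\<open>energy\<close> below). This
  reduces each statement about the nonlocal term to the same statement about the \<open>G\<close>-modular for a
  fixed \<open>h\<close>, followed by dominated convergence in \<open>h\<close>.

  A compactly supported Lipschitz function has difference quotients bounded by a constant times
  \<open>min 1 |h| / M |h|\<close>, so its energy is finite by (M3); this gives the inclusion. For density, a function
  \<open>u\<close> of the space is first multiplied by Lipschitz cutoffs (\<open>energy_cutoff\<close>). Since the difference
  quotient of \<open>\<theta> u\<close> is at most that of \<open>u\<close> plus \<open>|u| min 1 |h| / M |h|\<close> when \<open>\<theta>\<close> has values in \<open>[0, 1]\<close>
  and Lipschitz constant one, dominated convergence applies. Then the compactly supported function is
  convolved with a smooth mollifier \<open>\<rho>\<close>. By Jensen's inequality the modular of \<open>v - \<rho> * v\<close> is at most the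
  \<open>\<rho>\<close>-average of the modulars of \<open>v (\<cdot> + z) - v\<close> (\<open>modular_average_le\<close>, \<open>energy_average_le\<close>), and these are
  small for small \<open>z\<close> because translations are continuous in both modulars
  (\<open>modular_translation_continuous\<close>, \<open>energy_translation_continuous\<close>).
\<close>

section \<open>Young functions with power growth and their modulars\<close>

locale young =
  fixes G :: "real \<Rightarrow> real" and p q :: real
  assumes young: "young_function G" and growth: "growth p q G"
begin

lemma G_0 [simp]: "G 0 = 0" and G_even [simp]: "G (- t) = G t" and G_1 [simp]: "G 1 = 1"
  and convex_G: "convex_on UNIV G" and continuous_G: "continuous_on UNIV G"
  using young by (auto simp: young_function_def)

lemma one_less_p: "1 < p"
  using growth by (auto simp: growth_def)

lemma p_le_q: "p \<le> q"
  using growth by (auto simp: growth_def dest!: spec[of _ 1])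

lemma measurable_G [measurable]: "G \<in> borel_measurable borel"
  using continuous_G by (rule borel_measurable_continuous_onI)

lemma G_pos: "0 < G t" if "0 < t" for t
proof -
  have *: "strict_mono_on {0<..} G"
    using young by (simp add: young_function_def)
  have "(G \<longlongrightarrow> G 0) (at_right 0)"
    using continuous_G by (metis UNIV_I continuous_on_eq_continuous_within filterlim_at_split isCont_def)
  moreover have "eventually (\<lambda>s. G s \<le> G (t/2)) (at_right 0)"
    using eventually_at_right_real[of 0 "t/2"] that
    by (auto elim!: eventually_mono intro!: less_imp_le strict_mono_onD[OF *])
  ultimately have "G 0 \<le> G (t/2)"
    by (intro tendsto_upperbound) auto
  also have "G (t/2) < G t"
    using that by (intro strict_mono_onD[OF *]) auto
  finally show ?thesis by simp
qed

lemma G_nonneg [simp]: "0 \<le> G t"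
  using G_pos[of t] G_pos[of "- t"] by (cases "t = 0") (cases "0 < t"; auto)+

lemma G_abs [simp]: "G \<bar>t\<bar> = G t"
  by (simp add: abs_if)

lemma G_mono: "G s \<le> G t" if "\<bar>s\<bar> \<le> \<bar>t\<bar>" for s t
proof -
  have *: "strict_mono_on {0<..} G"
    using young by (simp add: young_function_def)
  have "G \<bar>s\<bar> \<le> G \<bar>t\<bar>"
    using that strict_mono_onD[OF *, of "\<bar>s\<bar>" "\<bar>t\<bar>"]
    by (cases "s = 0"; cases "t = 0"; cases "\<bar>s\<bar> = \<bar>t\<bar>") (auto simp del: G_abs)
  then show ?thesis by simp
qed

text \<open>With \<open>c = p\<close> or \<open>c = q\<close> the growth condition fixes the sign of this derivative, so that
  \<open>G t / t powr p\<close> is nondecreasing and \<open>G t / t powr q\<close> is nonincreasing; these are the next two lemmas.\<close>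

lemma log_G_derivative:
  assumes "0 < t"
  shows "((\<lambda>t. ln (G t) - c * ln t) has_real_derivative (t * deriv G t / G t - c) / t) (at t)"
proof -
  have "(G has_real_derivative deriv G t) (at t)"
    using growth assms by (auto simp: growth_def DERIV_deriv_iff_field_differentiable)
  then show ?thesis
    using assms G_pos[OF assms] by (auto intro!: derivative_eq_intros simp: field_simps)
qed

lemma G_shrink: "G (s * t) \<le> s powr p * G t" if "0 \<le> s" "s \<le> 1" for s t
proof (cases "s = 0 \<or> t = 0")
  case False
  define a where "a = \<bar>t\<bar>"
  have s: "0 < s" and a: "0 < a" using False that by (auto simp: a_def)
  have "ln (G (s * a)) - p * ln (s * a) \<le> ln (G a) - p * ln a"
  proof (rule DERIV_nonneg_imp_nondecreasing[where f = "\<lambda>t. ln (G t) - p * ln t"])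
    show "s * a \<le> a" using that a by (simp add: mult_left_le_one_le)
    fix x assume "s * a \<le> x"
    then have x: "0 < x" using s a by (meson less_le_trans mult_pos_pos)
    with growth have "0 \<le> (x * deriv G x / G x - p) / x" by (auto simp: growth_def)
    with log_G_derivative[OF x] show "\<exists>y. ((\<lambda>t. ln (G t) - p * ln t) has_real_derivative y) (at x) \<and> 0 \<le> y"
      by blast
  qed
  then have "ln (G (s * a)) \<le> ln (s powr p * G a)"
    using s a G_pos[OF a] by (simp add: ln_mult ln_powr algebra_simps)
  then have "G (s * a) \<le> s powr p * G a"
    using s a G_pos[OF a] G_pos[of "s * a"] by simp
  moreover have "G (s * a) = G (s * t)"
    using s G_abs[of "s * t"] by (simp add: a_def abs_mult)
  ultimately show ?thesis by (simp add: a_def)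
qed auto

lemma G_stretch: "G (s * t) \<le> s powr q * G t" if "1 \<le> s" for s t
proof (cases "t = 0")
  case False
  define a where "a = \<bar>t\<bar>"
  have s: "0 < s" and a: "0 < a" using False that by (auto simp: a_def)
  have "ln (G a) - q * ln a \<ge> ln (G (s * a)) - q * ln (s * a)"
  proof (rule DERIV_nonpos_imp_nonincreasing[where f = "\<lambda>t. ln (G t) - q * ln t"])
    show "a \<le> s * a" using that a by simp
    fix x assume "a \<le> x"
    then have x: "0 < x" using a by simp
    with growth have "0 \<ge> (x * deriv G x / G x - q) / x"
      by (auto simp: growth_def divide_le_0_iff)
    with log_G_derivative[OF x] show "\<exists>y. ((\<lambda>t. ln (G t) - q * ln t) has_real_derivative y) (at x) \<and> y \<le> 0"
      by blast
  qed
  then have "ln (G (s * a)) \<le> ln (s powr q * G a)"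
    using s a G_pos[OF a] by (simp add: ln_mult ln_powr algebra_simps)
  then have "G (s * a) \<le> s powr q * G a"
    using s a G_pos[OF a] G_pos[of "s * a"] by simp
  moreover have "G (s * a) = G (s * t)"
    using s G_abs[of "s * t"] by (simp add: a_def abs_mult)
  ultimately show ?thesis by (simp add: a_def)
qed auto

text \<open>Since \<open>G 1 = 1\<close> and \<open>p > 1\<close>, \<open>G\<close> grows at least linearly beyond 1. Hence a finite modular
  implies local integrability, which convolution needs.\<close>

lemma abs_le_G: "\<bar>t\<bar> \<le> 1 + G t"
proof (cases "1 \<le> \<bar>t\<bar>")
  case True
  have "1 = G (1 / \<bar>t\<bar> * \<bar>t\<bar>)"
    using True by auto
  also have "\<dots> \<le> (1 / \<bar>t\<bar>) powr p * G \<bar>t\<bar>"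
    using True by (intro G_shrink) auto
  also have "(1 / \<bar>t\<bar>) powr p \<le> (1 / \<bar>t\<bar>) powr 1"
    using True one_less_p by (intro powr_mono') auto
  finally have "1 \<le> (1 / \<bar>t\<bar>) powr 1 * G t"
    using True G_abs[of t] by (simp add: mult_right_mono)
  then show ?thesis using True by (simp add: field_simps)
qed (use G_nonneg[of t] in linarith)

text \<open>The doubling constant: \<open>G (2 t) \<le> \<Delta> * G t\<close> by \<open>G_stretch\<close>.\<close>

definition "\<Delta> = 2 powr q"

lemma Delta_ge_1: "1 \<le> \<Delta>"
  using one_less_p p_le_q by (simp add: \<Delta>_def ge_one_powr_ge_zero)

lemma G_add: "G (a + b) \<le> \<Delta> * (G a + G b)"
proof -
  have "G (a + b) \<le> G (2 * max \<bar>a\<bar> \<bar>b\<bar>)"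
    by (rule G_mono) auto
  also have "\<dots> \<le> \<Delta> * G (max \<bar>a\<bar> \<bar>b\<bar>)"
    unfolding \<Delta>_def by (rule G_stretch) auto
  also have "G (max \<bar>a\<bar> \<bar>b\<bar>) \<le> G a + G b"
    by (auto simp: max_def)
  finally show ?thesis using Delta_ge_1 by simp
qed

definition modular :: "('a::euclidean_space \<Rightarrow> real) \<Rightarrow> ennreal" where
  "modular u = (\<integral>\<^sup>+x. ennreal (G (u x)) \<partial>lborel)"

lemma modular_add:
  fixes a b :: "'a::euclidean_space \<Rightarrow> real"
  assumes [measurable]: "a \<in> borel_measurable borel" "b \<in> borel_measurable borel"
  shows "modular (\<lambda>x. a x + b x) \<le> ennreal \<Delta> * (modular a + modular b)"
proof -
  have "modular (\<lambda>x. a x + b x) \<le> (\<integral>\<^sup>+x. ennreal \<Delta> * (ennreal (G (a x)) + ennreal (G (b x))) \<partial>lborel)"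
    using G_add Delta_ge_1 unfolding modular_def
    by (intro nn_integral_mono) (auto simp flip: ennreal_plus ennreal_mult'' intro!: ennreal_leI)
  also have "\<dots> = ennreal \<Delta> * (modular a + modular b)"
    by (simp add: nn_integral_cmult nn_integral_add modular_def)
  finally show ?thesis .
qed

lemma modular_mono: "(\<And>x. \<bar>a x\<bar> \<le> \<bar>b x\<bar>) \<Longrightarrow> modular a \<le> modular b"
  unfolding modular_def by (intro nn_integral_mono ennreal_leI G_mono) auto

lemma modular_uminus: "modular (\<lambda>x. - a x) = modular a"
  by (simp add: modular_def)

lemma modular_diff:
  fixes a b :: "'a::euclidean_space \<Rightarrow> real"
  assumes "a \<in> borel_measurable borel" "b \<in> borel_measurable borel"
  shows "modular (\<lambda>x. a x - b x) \<le> ennreal \<Delta> * (modular a + modular b)"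
  using modular_add[of a "\<lambda>x. - b x"] assms by (simp add: modular_uminus)

end

section \<open>Continuity of translations\<close>

lemma tendsto_0_ennrealI:
  fixes f :: "'b \<Rightarrow> ennreal"
  assumes "\<And>e::real. 0 < e \<Longrightarrow> eventually (\<lambda>x. f x \<le> ennreal e) F"
  shows "(f \<longlongrightarrow> 0) F"
proof (rule order_tendstoI)
  fix a :: ennreal assume "0 < a"
  then obtain b where b: "0 < b" "b < a" using dense by blast
  then obtain e where e: "b = ennreal e" "0 < e"
    by (cases b) (auto simp: top_unique)
  show "eventually (\<lambda>x. f x < a) F"
    using assms[OF e(2)] by eventually_elim (use b e in auto)
qed auto

lemma eventually_less_ennreal:
  fixes f :: "'b \<Rightarrow> ennreal" and e :: real
  assumes "(f \<longlongrightarrow> 0) F" "0 < e"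
  shows "eventually (\<lambda>x. f x < ennreal e) F"
  using assms by (intro order_tendstoD(2)) auto

declare borel_closed[OF closed_cball, measurable]

lemma nn_integral_translate:
  fixes f :: "'a::euclidean_space \<Rightarrow> ennreal"
  assumes [measurable]: "f \<in> borel_measurable borel"
  shows "(\<integral>\<^sup>+x. f (x + c) \<partial>lborel) = (\<integral>\<^sup>+x. f x \<partial>lborel)"
  by (subst (2) lborel_distr_plus[of c, symmetric]) (simp add: nn_integral_distr add.commute)

context young
begin

lemma modular_translate:
  fixes u :: "'a::euclidean_space \<Rightarrow> real"
  assumes [measurable]: "u \<in> borel_measurable borel"
  shows "modular (\<lambda>x. u (x + c)) = modular u"
  unfolding modular_def by (rule nn_integral_translate) measurable

lemma modular_dominated_convergence:
  fixes v :: "nat \<Rightarrow> 'a::euclidean_space \<Rightarrow> real"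
  assumes [measurable]: "\<And>k. v k \<in> borel_measurable borel" "w \<in> borel_measurable borel"
    and dom: "\<And>k x. \<bar>v k x\<bar> \<le> \<bar>w x\<bar>" and w: "modular w < \<infinity>"
    and lim: "AE x in lborel. (\<lambda>k. v k x) \<longlonglongrightarrow> 0"
  shows "(\<lambda>k. modular (v k)) \<longlonglongrightarrow> 0"
proof -
  have "(\<lambda>k. \<integral>\<^sup>+x. ennreal (G (v k x)) \<partial>lborel) \<longlonglongrightarrow> (\<integral>\<^sup>+x. ennreal (G 0) \<partial>(lborel :: 'a measure))"
  proof (rule nn_integral_dominated_convergence)
    show "AE x in lborel. (\<lambda>k. ennreal (G (v k x))) \<longlonglongrightarrow> ennreal (G 0)"
      using lim
      by eventually_elim
        (intro tendsto_ennrealI continuous_on_tendsto_compose[OF continuous_G], auto)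
    show "(\<integral>\<^sup>+x. ennreal (G (w x)) \<partial>lborel) < \<infinity>"
      using w by (simp add: modular_def)
  qed (use dom in \<open>auto intro!: ennreal_leI G_mono\<close>)
  then show ?thesis by (simp add: modular_def)
qed

lemma modular_bounded_support_finite:
  fixes u :: "'a::euclidean_space \<Rightarrow> real"
  assumes "\<And>x. \<bar>u x\<bar> \<le> B" "\<And>x. R < norm x \<Longrightarrow> u x = 0"
  shows "modular u < \<infinity>"
proof -
  have "modular u \<le> (\<integral>\<^sup>+x. ennreal (G B) * indicator (cball (0::'a) R) x \<partial>lborel)"
    unfolding modular_def
  proof (intro nn_integral_mono)
    fix x show "ennreal (G (u x)) \<le> ennreal (G B) * indicator (cball 0 R) x"
      using assms[of x] by (cases "R < norm x") (auto simp: indicator_def intro!: ennreal_leI G_mono)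
  qed
  also have "\<dots> = ennreal (G B) * emeasure lborel (cball (0::'a) R)"
    by (simp add: nn_integral_cmult)
  also have "\<dots> < \<infinity>"
    using emeasure_bounded_finite[of "cball (0::'a) R"] by (simp add: ennreal_mult_less_top)
  finally show ?thesis .
qed

text \<open>Cut off to a bounded function of bounded support, represent that one as an almost everywhere
  limit of continuous functions, and clip these; both steps are controlled by dominated
  convergence.\<close>

lemma modular_approx_continuous:
  fixes u :: "'a::euclidean_space \<Rightarrow> real"
  assumes [measurable]: "u \<in> borel_measurable borel" and fin: "modular u < \<infinity>" and "0 < e"
  obtains g B R where "continuous_on UNIV g" "\<And>x. \<bar>g x\<bar> \<le> B" "\<And>x. R < norm x \<Longrightarrow> g x = 0"
    "modular (\<lambda>x. u x - g x) \<le> ennreal e"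
proof -
  define e' where "e' = e / (2 * \<Delta>)"
  have e': "0 < e'" using \<open>0 < e\<close> Delta_ge_1 by (simp add: e'_def)
  define v where "v k x = (if \<bar>u x\<bar> \<le> real k \<and> norm x \<le> real k then u x else 0)" for k x
  have [measurable]: "v k \<in> borel_measurable borel" for k
    unfolding v_def by measurable
  have "(\<lambda>k. modular (\<lambda>x. u x - v k x)) \<longlonglongrightarrow> 0"
  proof (rule modular_dominated_convergence[OF _ _ _ fin])
    show "AE x in lborel. (\<lambda>k. u x - v k x) \<longlonglongrightarrow> 0"
    proof (rule AE_I2)
      fix x
      have "eventually (\<lambda>k. u x - v k x = 0) sequentially"
        using eventually_ge_at_top[of "nat \<lceil>max \<bar>u x\<bar> (norm x)\<rceil>"]
        by eventually_elim (auto simp: v_def nat_le_iff ceiling_le_iff)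
      then show "(\<lambda>k. u x - v k x) \<longlonglongrightarrow> 0" by (rule tendsto_eventually)
    qed
  qed (auto simp: v_def)
  from eventually_happens[OF eventually_less_ennreal[OF this e']]
  obtain k where k: "modular (\<lambda>x. u x - v k x) < ennreal e'" by auto
  have "v k \<in> borel_measurable lebesgue" by (intro measurable_completion) simp
  then have "v k measurable_on UNIV"
    using lebesgue_measurable_imp_measurable_on by force
  then obtain S f where S: "negligible S" and f: "\<And>n. continuous_on UNIV (f n)"
    and lim: "\<And>x. x \<notin> S \<Longrightarrow> (\<lambda>n. f n x) \<longlonglongrightarrow> v k x"
    by (auto simp: measurable_on_def)
  define c where "c x = max 0 (min 1 (real k + 1 - norm x))" for x :: 'a
  define g where "g n x = max (- real k) (min (real k) (f n x)) * c x" for n x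
  have c: "0 \<le> c x" "c x \<le> 1" "real k + 1 < norm x \<Longrightarrow> c x = 0" "norm x \<le> real k \<Longrightarrow> c x = 1" for x
    by (auto simp: c_def)
  have g_cont: "continuous_on UNIV (g n)" for n
    unfolding g_def c_def by (intro continuous_intros f)
  have [measurable]: "g n \<in> borel_measurable borel" for n
    using g_cont by (rule borel_measurable_continuous_onI)
  have g_bound: "\<bar>g n x\<bar> \<le> real k" for n x
  proof -
    have "\<bar>max (- real k) (min (real k) (f n x))\<bar> * \<bar>c x\<bar> \<le> real k * 1"
      using c by (intro mult_mono) auto
    then show ?thesis by (simp add: g_def abs_mult)
  qed
  have "(\<lambda>n. modular (\<lambda>x. v k x - g n x)) \<longlonglongrightarrow> 0"
  proof (rule modular_dominated_convergence)
    let ?w = "\<lambda>x::'a. 2 * real k * indicator (cball 0 (real k + 1)) x"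
    show "modular ?w < \<infinity>"
      by (rule modular_bounded_support_finite[of _ "2 * real k" "real k + 1"]) (auto simp: indicator_def)
    show "\<bar>v k x - g n x\<bar> \<le> \<bar>?w x\<bar>" for n x
    proof (cases "norm x \<le> real k + 1")
      case True
      have "\<bar>v k x\<bar> \<le> real k" by (auto simp: v_def)
      with g_bound[of n x] True show ?thesis by auto
    qed (use c(3)[of x] in \<open>auto simp: v_def g_def\<close>)
    have "AE x in lebesgue. x \<notin> S"
      using S by (simp add: AE_not_in negligible_iff_null_sets)
    then have "AE x in lborel. x \<notin> S" by (simp add: AE_completion_iff)
    then show "AE x in lborel. (\<lambda>n. v k x - g n x) \<longlonglongrightarrow> 0"
    proof eventually_elim
      fix x assume "x \<notin> S"
      from lim[OF this] have "(\<lambda>n. v k x - g n x) \<longlonglongrightarrow> v k x - max (- real k) (min (real k) (v k x)) * c x"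
        unfolding g_def by (intro tendsto_intros)
      also have "v k x - max (- real k) (min (real k) (v k x)) * c x = 0"
        using c(4)[of x] by (auto simp: v_def)
      finally show "(\<lambda>n. v k x - g n x) \<longlonglongrightarrow> 0" .
    qed
  qed measurable
  from eventually_happens[OF eventually_less_ennreal[OF this e']]
  obtain n where n: "modular (\<lambda>x. v k x - g n x) < ennreal e'" by auto
  have "modular (\<lambda>x. u x - g n x) = modular (\<lambda>x. (u x - v k x) + (v k x - g n x))" by simp
  also have "\<dots> \<le> ennreal \<Delta> * (modular (\<lambda>x. u x - v k x) + modular (\<lambda>x. v k x - g n x))"
    by (rule modular_add) measurable
  also have "\<dots> \<le> ennreal \<Delta> * (ennreal e' + ennreal e')"
    using k n by (intro mult_left_mono add_mono) auto
  also have "\<dots> = ennreal e"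
    using e' Delta_ge_1 by (simp add: e'_def flip: ennreal_plus ennreal_mult'')
  finally show ?thesis
    using that[of "g n" "real k" "real k + 1"] g_cont g_bound c(3) by (auto simp: g_def)
qed

text \<open>The translated differences all live in one ball, because a convergent sequence of shifts is
  bounded; on it dominated convergence applies.\<close>

lemma modular_translation_continuous_compact_support:
  fixes g :: "'a::euclidean_space \<Rightarrow> real"
  assumes g: "continuous_on UNIV g" "\<And>x. \<bar>g x\<bar> \<le> B" "\<And>x. R < norm x \<Longrightarrow> g x = 0"
    and Z: "Z \<longlonglongrightarrow> 0"
  shows "(\<lambda>k. modular (\<lambda>x. g (x + Z k) - g x)) \<longlonglongrightarrow> 0"
proof -
  have [measurable]: "g \<in> borel_measurable borel"
    using g(1) by (rule borel_measurable_continuous_onI)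
  obtain D where D: "\<And>k. norm (Z k) \<le> D"
    using Z convergentI convergent_imp_Bseq BseqE by metis
  have B: "0 \<le> B" using g(2)[of undefined] by linarith
  show ?thesis
  proof (rule modular_dominated_convergence)
    let ?w = "\<lambda>x::'a. 2 * B * indicator (cball 0 (R + D)) x"
    show "modular ?w < \<infinity>"
      using B by (intro modular_bounded_support_finite[of _ "2 * B" "R + D"]) (auto simp: indicator_def)
    show "\<bar>g (x + Z k) - g x\<bar> \<le> \<bar>?w x\<bar>" for k x
    proof (cases "norm x \<le> R + D")
      case True
      then show ?thesis using g(2)[of "x + Z k"] g(2)[of x] B by auto
    next
      case False
      then have "R < norm x" "R < norm (x + Z k)"
        using D[of k] norm_triangle_ineq2[of x "- Z k"] order_trans[OF norm_ge_zero D[of k]] by auto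
      then show ?thesis using g(3) by simp
    qed
    show "AE x in lborel. (\<lambda>k. g (x + Z k) - g x) \<longlonglongrightarrow> 0"
    proof (rule AE_I2)
      fix x
      have "(\<lambda>k. x + Z k) \<longlonglongrightarrow> x + 0" by (intro tendsto_intros Z)
      then have "(\<lambda>k. g (x + Z k)) \<longlonglongrightarrow> g (x + 0)"
        by (intro continuous_on_tendsto_compose[OF g(1)]) auto
      then show "(\<lambda>k. g (x + Z k) - g x) \<longlonglongrightarrow> 0" by (simp add: LIM_zero)
    qed
  qed measurable
qed

text \<open>A three-term estimate: \<open>u\<close> and its translate are both close to a continuous function of
  bounded support and to its translate, because the Lebesgue measure is translation invariant.\<close>

theorem modular_translation_continuous:
  fixes u :: "'a::euclidean_space \<Rightarrow> real"
  assumes [measurable]: "u \<in> borel_measurable borel" and fin: "modular u < \<infinity>" and Z: "Z \<longlonglongrightarrow> 0"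
  shows "(\<lambda>k. modular (\<lambda>x. u (x + Z k) - u x)) \<longlonglongrightarrow> 0"
proof (rule tendsto_0_ennrealI)
  fix e :: real assume "0 < e"
  \<comment> \<open>The triangle inequality is used twice, each time at the cost of a factor \<open>\<Delta>\<close>; \<open>d\<close> absorbs them.\<close>
  define d where "d = e / (\<Delta> + 2 * \<Delta> * \<Delta>)"
  have pos: "0 < \<Delta> + 2 * \<Delta> * \<Delta>"
    using Delta_ge_1 by (intro add_pos_pos mult_pos_pos) auto
  then have "0 < d" "(\<Delta> + 2 * \<Delta> * \<Delta>) * d = e"
    using \<open>0 < e\<close> by (auto simp: d_def)
  then have d: "0 < d" "\<Delta> * d + \<Delta> * (\<Delta> * (d + d)) = e"
    by (auto simp: algebra_simps)
  obtain g B R where g: "continuous_on UNIV g" "\<And>x. \<bar>g x\<bar> \<le> B" "\<And>x. R < norm x \<Longrightarrow> g x = 0"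
    and near: "modular (\<lambda>x. u x - g x) \<le> ennreal d"
    using modular_approx_continuous[OF assms(1) fin d(1)] by blast
  have [measurable]: "g \<in> borel_measurable borel"
    using g(1) by (rule borel_measurable_continuous_onI)
  have "(\<lambda>k. modular (\<lambda>x. g (x + Z k) - g x)) \<longlonglongrightarrow> 0"
    by (rule modular_translation_continuous_compact_support[OF g(1,2) g(3) Z])
  from eventually_less_ennreal[OF this d(1)]
  show "eventually (\<lambda>k. modular (\<lambda>x. u (x + Z k) - u x) \<le> ennreal e) sequentially"
  proof eventually_elim
    fix k assume k: "modular (\<lambda>x. g (x + Z k) - g x) < ennreal d"
    let ?D = "\<lambda>x. u x - g x"
    have "modular (\<lambda>x. u (x + Z k) - u x) = modular (\<lambda>x. ?D (x + Z k) + ((g (x + Z k) - g x) - ?D x))"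
      by (simp add: algebra_simps)
    also have "\<dots> \<le> ennreal \<Delta> * (modular (\<lambda>x. ?D (x + Z k)) + modular (\<lambda>x. (g (x + Z k) - g x) - ?D x))"
      by (rule modular_add) measurable
    also have "\<dots> \<le> ennreal \<Delta> * (modular (\<lambda>x. ?D (x + Z k))
        + ennreal \<Delta> * (modular (\<lambda>x. g (x + Z k) - g x) + modular ?D))"
      by (intro mult_left_mono add_left_mono modular_diff) simp_all
    also have "modular (\<lambda>x. ?D (x + Z k)) = modular ?D"
      by (rule modular_translate) measurable
    also have "ennreal \<Delta> * (modular ?D + ennreal \<Delta> * (modular (\<lambda>x. g (x + Z k) - g x) + modular ?D))
      \<le> ennreal \<Delta> * (ennreal d + ennreal \<Delta> * (ennreal d + ennreal d))"
      using k near by (intro mult_left_mono add_mono) auto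
    also have "\<dots> = ennreal e"
      using d Delta_ge_1 by (simp add: distrib_left flip: ennreal_plus ennreal_mult'')
    finally show "modular (\<lambda>x. u (x + Z k) - u x) \<le> ennreal e" .
  qed
qed

end

section \<open>Polar coordinates and the radial kernel\<close>

text \<open>Both measures assign the volume of the ball of radius \<open>r\<close> to \<open>{..r}\<close>: the density is the
  derivative of \<open>unit_ball_vol n * r ^ n\<close>.\<close>

lemma distr_norm_lborel:
  "distr (lborel :: 'a::euclidean_space measure) borel norm
    = density lborel (\<lambda>r. ennreal (unit_ball_vol DIM('a) * (DIM('a) * r ^ (DIM('a) - 1))) * indicator {0..} r)"
    (is "?D = ?E")
proof (rule measure_eqI_generator_eq[where E = "range atMost" and \<Omega> = UNIV and A = "\<lambda>i. {..real i}"])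
  let ?n = "DIM('a)" and ?c = "unit_ball_vol DIM('a)"
  have *: "emeasure ?D {..r} = ennreal (?c * r ^ ?n) \<and> emeasure ?E {..r} = ennreal (?c * r ^ ?n)"
    if "0 \<le> r" for r
  proof
    have "emeasure ?D {..r} = emeasure (lborel :: 'a measure) (cball 0 r)"
      by (subst emeasure_distr) (auto intro!: arg_cong[where f = "emeasure lborel"])
    then show "emeasure ?D {..r} = ennreal (?c * r ^ ?n)"
      using that by (simp add: emeasure_cball)
    have "emeasure ?E {..r} = (\<integral>\<^sup>+s. ennreal (?c * (?n * s ^ (?n - 1))) * indicator {0..r} s \<partial>lborel)"
      by (subst emeasure_density) (auto intro!: nn_integral_cong simp: indicator_def)
    also have "\<dots> = ennreal (?c * r ^ ?n - ?c * 0 ^ ?n)"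
      using that
      by (intro nn_integral_FTC_Icc)
        (auto intro!: derivative_eq_intros has_real_derivative_imp_continuous_on continuous_intros
          simp flip: has_real_derivative_iff_has_vector_derivative)
    also have "(0::real) ^ ?n = 0" by (rule zero_power) simp
    finally show "emeasure ?E {..r} = ennreal (?c * r ^ ?n)"
      by simp
  qed
  show "emeasure ?D X = emeasure ?E X" if "X \<in> range atMost" for X
  proof -
    from that obtain r where r: "X = {..r}" by auto
    show ?thesis
    proof (cases "0 \<le> r")
      case False
      then have "norm -` {..r} = ({} :: 'a set)"
        by (auto simp: not_le) (metis norm_ge_zero not_le order_less_le_trans)
      then have "emeasure ?D {..r} = 0"
        by (subst emeasure_distr) auto
      moreover have "emeasure ?E {..r}
          = (\<integral>\<^sup>+s. ennreal (?c * (?n * s ^ (?n - 1))) * indicator {0..} s * indicator {..r} s \<partial>lborel)"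
        by (subst emeasure_density) auto
      moreover have "\<dots> = (\<integral>\<^sup>+s. 0 \<partial>(lborel :: real measure))"
        using False by (intro nn_integral_cong) (auto simp: indicator_def)
      ultimately show ?thesis by (simp add: r)
    next
      case True
      then show ?thesis using *[OF True] unfolding r by metis
    qed
  qed
  show "emeasure ?D {..real i} \<noteq> \<infinity>" for i
    using *[of "real i"] by simp
  show "(\<Union>i. {..real i}) = UNIV"
    using real_arch_simple by auto
  show "Int_stable (range atMost :: real set set)"
    by (auto simp: Int_stable_def)
qed (auto simp: borel_eq_atMost)

lemma nn_integral_radial:
  assumes [measurable]: "f \<in> borel_measurable borel"
  shows "(\<integral>\<^sup>+x. f (norm x) \<partial>(lborel :: 'a::euclidean_space measure))
    = (\<integral>\<^sup>+r. ennreal (unit_ball_vol DIM('a) * (DIM('a) * r ^ (DIM('a) - 1))) * indicator {0..} r * f r \<partial>lborel)"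
proof -
  have "(\<integral>\<^sup>+x. f (norm x) \<partial>(lborel :: 'a measure)) = (\<integral>\<^sup>+r. f r \<partial>distr (lborel :: 'a measure) borel norm)"
    by (simp add: nn_integral_distr)
  then show ?thesis
    by (simp add: distr_norm_lborel nn_integral_density)
qed

lemma borel_measurable_mono_on_nonneg:
  fixes f :: "real \<Rightarrow> real"
  assumes "mono_on {0..} f"
  shows "(\<lambda>x::'a::euclidean_space. f (norm x)) \<in> borel_measurable borel"
proof -
  have "mono (\<lambda>r. f (max r 0))"
    using assms by (auto intro!: monoI elim!: mono_onD)
  then have [measurable]: "(\<lambda>r. f (max r 0)) \<in> borel_measurable borel"
    by (rule borel_measurable_mono)
  have "(\<lambda>x::'a. f (max (norm x) 0)) \<in> borel_measurable borel" by measurable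
  then show "(\<lambda>x::'a::euclidean_space. f (norm x)) \<in> borel_measurable borel" by simp
qed

text \<open>The type argument carries the dimension, on which (M3) depends.\<close>

locale nonlocal_energy = young G p q for G :: "real \<Rightarrow> real" and p q +
  fixes M N :: "real \<Rightarrow> real" and dimension :: "'a::euclidean_space itself"
  assumes M_nonneg: "\<And>r. 0 \<le> r \<Longrightarrow> 0 \<le> M r" and N_nonneg: "\<And>r. 0 \<le> r \<Longrightarrow> 0 \<le> N r"
    and M1: "cond_M1 M N" and M2: "cond_M2 M N" and M3: "cond_M3 DIM('a) p M N"
begin

lemma measurable_M [measurable]: "(\<lambda>h::'a. M (norm h)) \<in> borel_measurable borel"
  and measurable_N [measurable]: "(\<lambda>h::'a. N (norm h)) \<in> borel_measurable borel"
  using M1 by (auto simp: cond_M1_def intro!: borel_measurable_mono_on_nonneg)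

text \<open>A bound for difference quotients: a function with values in
  \<open>[0, 1]\<close> and Lipschitz constant one has \<open>|f x - f (x + h)| / M |h| \<le> step_ratio h\<close>. By (M2) it does not
  exceed one, so its \<open>p\<close>-th power can be pulled out of \<open>G\<close> by \<open>G_shrink\<close>.\<close>

definition step_ratio :: "'a \<Rightarrow> real" where
  "step_ratio h = min 1 (norm h) / M (norm h)"

lemma measurable_step_ratio [measurable]: "step_ratio \<in> borel_measurable borel"
  unfolding step_ratio_def by measurable

lemma step_ratio_nonneg: "0 \<le> step_ratio h"
  unfolding step_ratio_def by (simp add: M_nonneg)

lemma step_ratio_le_1: "step_ratio h \<le> 1"
proof -
  have "min 1 (norm h) \<le> M (norm h)" using M2 by (simp add: cond_M2_def)
  then show ?thesis unfolding step_ratio_def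
    using M_nonneg[of "norm h"] by (auto simp: divide_le_eq_1 less_le)
qed

definition weight :: "'a \<Rightarrow> ennreal" where
  "weight h = ennreal (1 / N (norm h))"

lemma measurable_weight [measurable]: "weight \<in> borel_measurable borel"
  unfolding weight_def by measurable

lemma weight_finite [simp]: "weight h < \<infinity>" by (simp add: weight_def)

text \<open>This is what (M3) says once the integral is written in polar coordinates: for \<open>r \<le> 1\<close> the
  integrand is, up to a constant factor, that of the first integral in (M3), for \<open>r \<ge> 1\<close> that of the
  second.\<close>

lemma nn_integral_step_ratio_finite:
  "(\<integral>\<^sup>+h. weight h * ennreal (step_ratio h powr p) \<partial>lborel) < \<infinity>"
proof -
  define N' where "N' r = N (max r 0)" for r
  define M' where "M' r = M (max r 0)" for r
  have "mono N'" "mono M'"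
    unfolding N'_def M'_def using M1 by (auto intro!: monoI elim!: mono_onD simp: cond_M1_def)
  then have [measurable]: "N' \<in> borel_measurable borel" "M' \<in> borel_measurable borel"
    by (auto intro: borel_measurable_mono)
  define c where "c = unit_ball_vol DIM('a) * DIM('a)"
  have c: "0 \<le> c" by (simp add: c_def)
  define f where "f r = ennreal (1 / N' r * (min 1 r / M' r) powr p)" for r
  have [measurable]: "f \<in> borel_measurable borel" unfolding f_def by measurable
  define a where "a r = r powr (real DIM('a) - 1 + p) / (N' r * M' r powr p)" for r
  define b where "b r = r powr (real DIM('a) - 1) / (N' r * M' r powr p)" for r
  have [measurable]: "a \<in> borel_measurable borel" "b \<in> borel_measurable borel"
    unfolding a_def b_def by measurable
  have "(\<integral>\<^sup>+h. weight h * ennreal (step_ratio h powr p) \<partial>lborel) = (\<integral>\<^sup>+h. f (norm h) \<partial>(lborel :: 'a measure))"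
    by (intro nn_integral_cong)
      (auto simp: weight_def f_def step_ratio_def N'_def M'_def N_nonneg simp flip: ennreal_mult')
  also have "\<dots> = (\<integral>\<^sup>+r. ennreal (unit_ball_vol DIM('a) * (DIM('a) * r ^ (DIM('a) - 1))) * indicator {0..} r * f r \<partial>lborel)"
    by (rule nn_integral_radial) measurable
  also have "\<dots> \<le> (\<integral>\<^sup>+r. ennreal c * (ennreal (a r) * indicator {0..1} r + ennreal (b r) * indicator {1..} r) \<partial>lborel)"
  proof (rule nn_integral_mono_AE)
    have "AE r in lborel. r \<noteq> (0::real)" by (rule AE_lborel_singleton)
    then show "AE r in lborel. ennreal (unit_ball_vol DIM('a) * (DIM('a) * r ^ (DIM('a) - 1))) * indicator {0..} r * f r
      \<le> ennreal c * (ennreal (a r) * indicator {0..1} r + ennreal (b r) * indicator {1..} r)"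
    proof eventually_elim
      fix r :: real assume r: "r \<noteq> 0"
      have pw: "r ^ (DIM('a) - 1) = r powr (real DIM('a) - 1)" if "0 < r"
        using that powr_realpow[of r "DIM('a) - 1"] by (simp add: of_nat_diff)
      have nn: "0 \<le> N' r" "0 \<le> M' r" "0 \<le> M' r powr p" by (auto simp: N'_def M'_def N_nonneg M_nonneg)
      consider "r < 0" | "0 < r" "r \<le> 1" | "1 < r" using r by linarith
      then show "ennreal (unit_ball_vol DIM('a) * (DIM('a) * r ^ (DIM('a) - 1))) * indicator {0..} r * f r
      \<le> ennreal c * (ennreal (a r) * indicator {0..1} r + ennreal (b r) * indicator {1..} r)"
      proof cases
        case 1
        then show ?thesis by simp
      next
        case 2
        have "ennreal (unit_ball_vol DIM('a) * (DIM('a) * r ^ (DIM('a) - 1))) * f r = ennreal c * ennreal (a r)"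
          using 2 nn c unfolding f_def a_def c_def
          by (subst pw) (auto simp: powr_divide powr_add min_absorb2 mult_ac simp flip: ennreal_mult')
        then show ?thesis using 2 by (simp add: distrib_left)
      next
        case 3
        have "ennreal (unit_ball_vol DIM('a) * (DIM('a) * r ^ (DIM('a) - 1))) * f r = ennreal c * ennreal (b r)"
          using 3 nn c unfolding f_def b_def c_def
          by (subst pw) (auto simp: powr_divide mult_ac simp flip: ennreal_mult')
        then show ?thesis using 3 by simp
      qed
    qed
  qed
  also have "\<dots> = ennreal c * ((\<integral>\<^sup>+r. ennreal (a r) * indicator {0..1} r \<partial>lborel) + (\<integral>\<^sup>+r. ennreal (b r) * indicator {1..} r \<partial>lborel))"
    by (simp add: nn_integral_cmult nn_integral_add)
  also have "(\<integral>\<^sup>+r. ennreal (a r) * indicator {0..1} r \<partial>lborel)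
      = (\<integral>\<^sup>+r\<in>{0..1}. ennreal (r powr (real DIM('a) - 1 + p) / (N r * M r powr p)) \<partial>lborel)"
    by (intro nn_integral_cong) (auto simp: a_def N'_def M'_def indicator_def)
  also have "(\<integral>\<^sup>+r. ennreal (b r) * indicator {1..} r \<partial>lborel)
      = (\<integral>\<^sup>+r\<in>{1..}. ennreal (r powr (real DIM('a) - 1) / (N r * M r powr p)) \<partial>lborel)"
    by (intro nn_integral_cong) (auto simp: b_def N'_def M'_def indicator_def)
  finally show ?thesis
    using M3 by (auto simp: cond_M3_def ennreal_mult_less_top elim!: order_le_less_trans)
qed

end

section \<open>The nonlocal energy\<close>

context young
begin

lemma modular_scale_le:
  fixes u :: "'a::euclidean_space \<Rightarrow> real"
  assumes [measurable]: "u \<in> borel_measurable borel" and "0 \<le> s" "s \<le> 1"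
  shows "modular (\<lambda>x. s * u x) \<le> ennreal (s powr p) * modular u"
proof -
  have "modular (\<lambda>x. s * u x) \<le> (\<integral>\<^sup>+x. ennreal (s powr p) * ennreal (G (u x)) \<partial>lborel)"
    unfolding modular_def using G_shrink[OF assms(2,3)]
    by (intro nn_integral_mono) (simp flip: ennreal_mult'')
  then show ?thesis by (simp add: nn_integral_cmult modular_def)
qed

lemma borel_measurable_modular [measurable (raw)]:
  fixes u :: "'b \<Rightarrow> 'a::euclidean_space \<Rightarrow> real"
  assumes [measurable]: "(\<lambda>(h, x). u h x) \<in> borel_measurable (M \<Otimes>\<^sub>M borel)"
  shows "(\<lambda>h. modular (u h)) \<in> borel_measurable M"
  unfolding modular_def by measurable

end

context nonlocal_energy
begin

definition quotient :: "('a \<Rightarrow> real) \<Rightarrow> 'a \<Rightarrow> 'a \<Rightarrow> real" where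
  "quotient u h x = (u x - u (x + h)) / M (norm h)"

text \<open>The modular of the seminorm after the substitution \<open>y = x + h\<close>; the identity with the double
  integral is \<open>nn_integral_pair_eq_energy\<close> below. In this form, translating \<open>u\<close> acts on each inner modular
  separately.\<close>

definition energy :: "('a \<Rightarrow> real) \<Rightarrow> ennreal" where
  "energy u = (\<integral>\<^sup>+h. weight h * modular (quotient u h) \<partial>lborel)"

lemma measurable_quotient_pair [measurable]:
  assumes [measurable]: "u \<in> borel_measurable borel"
  shows "(\<lambda>(h, x). quotient u h x) \<in> borel_measurable (borel \<Otimes>\<^sub>M borel)"
  unfolding quotient_def by measurable

lemma measurable_quotient [measurable]:
  assumes [measurable]: "u \<in> borel_measurable borel"
  shows "quotient u h \<in> borel_measurable borel"
  unfolding quotient_def by measurable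

lemma measurable_modular_quotient [measurable]:
  assumes [measurable]: "u \<in> borel_measurable borel"
  shows "(\<lambda>h. modular (quotient u h)) \<in> borel_measurable borel"
  by measurable

lemma energy_add:
  assumes [measurable]: "a \<in> borel_measurable borel" "b \<in> borel_measurable borel"
  shows "energy (\<lambda>x. a x + b x) \<le> ennreal \<Delta> * (energy a + energy b)"
proof -
  have "energy (\<lambda>x. a x + b x)
    \<le> (\<integral>\<^sup>+h. ennreal \<Delta> * (weight h * modular (quotient a h) + weight h * modular (quotient b h)) \<partial>lborel)"
    unfolding energy_def
  proof (intro nn_integral_mono)
    fix h :: 'a
    have "quotient (\<lambda>x. a x + b x) h = (\<lambda>x. quotient a h x + quotient b h x)"
      by (auto simp: quotient_def fun_eq_iff add_divide_distrib diff_divide_distrib)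
    then have "modular (quotient (\<lambda>x. a x + b x) h) \<le> ennreal \<Delta> * (modular (quotient a h) + modular (quotient b h))"
      using modular_add[of "quotient a h" "quotient b h"] by simp
    then have "weight h * modular (quotient (\<lambda>x. a x + b x) h)
        \<le> weight h * (ennreal \<Delta> * (modular (quotient a h) + modular (quotient b h)))"
      by (rule mult_left_mono) simp
    then show "weight h * modular (quotient (\<lambda>x. a x + b x) h)
        \<le> ennreal \<Delta> * (weight h * modular (quotient a h) + weight h * modular (quotient b h))"
      by (simp add: distrib_left mult_ac)
  qed
  then show ?thesis
    by (simp add: energy_def nn_integral_cmult nn_integral_add)
qed

text \<open>Dominated convergence in \<open>h\<close>. The inner limit is only required where the bound \<open>W\<close> is finite,
  which is the case almost everywhere on the set where the weight is positive.\<close>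

lemma energy_tendsto_0:
  assumes [measurable]: "\<And>k. v k \<in> borel_measurable borel" "W \<in> borel_measurable borel"
    and dom: "\<And>k h. modular (quotient (v k) h) \<le> W h"
    and fin: "(\<integral>\<^sup>+h. weight h * W h \<partial>lborel) < \<infinity>"
    and lim: "\<And>h. W h < \<infinity> \<Longrightarrow> (\<lambda>k. modular (quotient (v k) h)) \<longlonglongrightarrow> 0"
  shows "(\<lambda>k. energy (v k)) \<longlonglongrightarrow> 0"
proof -
  have "(\<lambda>k. \<integral>\<^sup>+h. weight h * modular (quotient (v k) h) \<partial>lborel) \<longlonglongrightarrow> (\<integral>\<^sup>+h. 0 \<partial>(lborel :: 'a measure))"
  proof (rule nn_integral_dominated_convergence[where w = "\<lambda>h. weight h * W h"])
    show "AE h in lborel. weight h * modular (quotient (v j) h) \<le> weight h * W h" for j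
      using dom by (auto intro!: mult_left_mono)
    have "AE h in lborel. weight h * W h \<noteq> \<infinity>"
      using fin by (intro nn_integral_PInf_AE) auto
    then show "AE h in lborel. (\<lambda>k. weight h * modular (quotient (v k) h)) \<longlonglongrightarrow> 0"
    proof eventually_elim
      fix h assume *: "weight h * W h \<noteq> \<infinity>"
      show "(\<lambda>k. weight h * modular (quotient (v k) h)) \<longlonglongrightarrow> 0"
      \<comment> \<open>The weight may vanish at \<open>h = 0\<close> (division by \<open>N 0 = 0\<close>), and there \<open>W h\<close> may be infinite.\<close>
      proof (cases "weight h = 0")
        case False
        with * have "W h < \<infinity>" by (auto simp: ennreal_mult_eq_top_iff less_top)
        then have "(\<lambda>k. weight h * modular (quotient (v k) h)) \<longlonglongrightarrow> weight h * 0"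
          using weight_finite[of h] by (intro ennreal_tendsto_cmult lim) auto
        then show ?thesis by simp
      qed simp
    qed
  qed (use fin in \<open>auto simp: top_unique\<close>)
  then show ?thesis by (simp add: energy_def)
qed

text \<open>For fixed \<open>h\<close> this is continuity of translations in the \<open>G\<close>-modular, applied to the difference
  quotient; the modulars of all translates coincide, which gives a bound independent of the shift.\<close>

theorem energy_translation_continuous:
  assumes [measurable]: "u \<in> borel_measurable borel" and fin: "energy u < \<infinity>" and Z: "Z \<longlonglongrightarrow> 0"
  shows "(\<lambda>k. energy (\<lambda>x. u (x + Z k) - u x)) \<longlonglongrightarrow> 0"
proof (rule energy_tendsto_0)
  let ?W = "\<lambda>h. ennreal \<Delta> * (modular (quotient u h) + modular (quotient u h))"
  have eq: "quotient (\<lambda>x. u (x + z) - u x) h = (\<lambda>x. quotient u h (x + z) - quotient u h x)" for z h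
    unfolding quotient_def diff_divide_distrib[symmetric] by (simp add: fun_eq_iff algebra_simps)
  show "modular (quotient (\<lambda>x. u (x + Z k) - u x) h) \<le> ?W h" for k h
    using modular_diff[of "\<lambda>x. quotient u h (x + Z k)" "quotient u h"] modular_translate[of "quotient u h" "Z k"]
    by (simp add: eq)
  have "(\<integral>\<^sup>+h. weight h * ?W h \<partial>lborel) = ennreal \<Delta> * (energy u + energy u)"
    by (simp add: energy_def nn_integral_add[symmetric] nn_integral_cmult[symmetric] distrib_left mult_ac)
  then show "(\<integral>\<^sup>+h. weight h * ?W h \<partial>lborel) < \<infinity>"
    using fin by (simp add: ennreal_mult_less_top)
  show "(\<lambda>k. modular (quotient (\<lambda>x. u (x + Z k) - u x) h)) \<longlonglongrightarrow> 0" if "?W h < \<infinity>" for h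
  proof -
    have "modular (quotient u h) < \<infinity>"
      using that Delta_ge_1 by (auto simp: ennreal_mult_less_top)
    then show ?thesis
      unfolding eq by (intro modular_translation_continuous Z) auto
  qed
qed measurable

text \<open>If neither \<open>x\<close> nor \<open>x + h\<close> lies in the supporting ball, the difference quotient vanishes; otherwise it
  is at most \<open>B * step_ratio h\<close>. The modular of the two indicators is finite and does not depend on \<open>h\<close>.\<close>

lemma energy_finite_bounded_Lipschitz:
  assumes [measurable]: "f \<in> borel_measurable borel"
    and lip: "\<And>x h. \<bar>f x - f (x + h)\<bar> \<le> B * min 1 (norm h)"
    and supp: "\<And>x. R < norm x \<Longrightarrow> f x = 0"
  shows "energy f < \<infinity>"
proof -
  have B: "0 \<le> B"
  proof (rule ccontr)
    assume "\<not> 0 \<le> B"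
    \<comment> \<open>Any nonzero increment contradicts a negative Lipschitz constant.\<close>
    obtain b :: 'a where "b \<in> Basis" using nonempty_Basis by blast
    with lip[of 0 b] \<open>\<not> 0 \<le> B\<close> show False by simp
  qed
  define I where "I x = B * indicator (cball 0 R) x" for x :: 'a
  have [measurable]: "I \<in> borel_measurable borel" unfolding I_def by measurable
  have I: "modular I < \<infinity>"
    using B by (intro modular_bounded_support_finite[of _ B R]) (auto simp: I_def indicator_def)
  let ?K = "ennreal \<Delta> * (modular I + modular I)"
  have "modular (quotient f h) \<le> ennreal (step_ratio h powr p) * ?K" for h
  proof -
    have "modular (quotient f h) \<le> modular (\<lambda>x. step_ratio h * (I x + I (x + h)))"
    proof (rule modular_mono)
      fix x
      have "\<bar>f x - f (x + h)\<bar> \<le> min 1 (norm h) * (I x + I (x + h))"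
      proof (cases "norm x \<le> R \<or> norm (x + h) \<le> R")
        case True
        then have "B \<le> I x + I (x + h)" using B by (auto simp: I_def)
        then have "min 1 (norm h) * B \<le> min 1 (norm h) * (I x + I (x + h))"
          by (intro mult_left_mono) auto
        with lip[of x h] show ?thesis by (simp add: mult.commute)
      qed (use supp B in \<open>auto simp: I_def\<close>)
      then have "\<bar>f x - f (x + h)\<bar> / M (norm h) \<le> min 1 (norm h) * (I x + I (x + h)) / M (norm h)"
        by (intro divide_right_mono) (auto simp: M_nonneg)
      also have "\<dots> = step_ratio h * (I x + I (x + h))" by (simp add: step_ratio_def)
      finally show "\<bar>quotient f h x\<bar> \<le> \<bar>step_ratio h * (I x + I (x + h))\<bar>"
        by (simp add: quotient_def M_nonneg)
    qed
    also have "\<dots> \<le> ennreal (step_ratio h powr p) * modular (\<lambda>x. I x + I (x + h))"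
      by (intro modular_scale_le step_ratio_nonneg step_ratio_le_1) measurable
    also have "modular (\<lambda>x. I x + I (x + h)) \<le> ?K"
      using modular_add[of I "\<lambda>x. I (x + h)"] modular_translate[of I h] by simp
    finally show ?thesis by (simp add: mult_left_mono)
  qed
  then have "energy f \<le> (\<integral>\<^sup>+h. ?K * (weight h * ennreal (step_ratio h powr p)) \<partial>lborel)"
    unfolding energy_def
    by (intro nn_integral_mono) (metis mult.assoc mult.commute mult_left_mono zero_le)
  also have "\<dots> = ?K * (\<integral>\<^sup>+h. weight h * ennreal (step_ratio h powr p) \<partial>lborel)"
    by (rule nn_integral_cmult) measurable
  also have "\<dots> < \<infinity>"
    using I nn_integral_step_ratio_finite by (simp add: ennreal_mult_less_top)
  finally show ?thesis .
qed

text \<open>Equal to one on the ball of radius \<open>k + 1\<close> and to zero outside the ball of twice that radius. The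
  radius starts at one so that all cutoffs share the Lipschitz constant one.\<close>

definition cutoff :: "nat \<Rightarrow> 'a \<Rightarrow> real" where
  "cutoff k x = max 0 (min 1 (2 - norm x / (real k + 1)))"

lemma measurable_cutoff [measurable]: "cutoff k \<in> borel_measurable borel"
  unfolding cutoff_def by measurable

lemma cutoff_bounds: "0 \<le> cutoff k x" "cutoff k x \<le> 1" by (auto simp: cutoff_def)

lemma cutoff_eq_0: "2 * (real k + 1) < norm x \<Longrightarrow> cutoff k x = 0"
  by (simp add: cutoff_def field_simps max_def)

lemma eventually_cutoff_eq_1: "eventually (\<lambda>k. cutoff k x = 1) sequentially"
  using eventually_ge_at_top[of "nat \<lceil>norm x\<rceil>"]
proof eventually_elim
  fix k assume "nat \<lceil>norm x\<rceil> \<le> k"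
  then have "norm x \<le> real k + 1" by linarith
  then have "norm x / (real k + 1) \<le> 1" by simp
  then show "cutoff k x = 1" by (simp add: cutoff_def)
qed

lemma cutoff_Lipschitz: "\<bar>cutoff k x - cutoff k (x + h)\<bar> \<le> min 1 (norm h)"
proof -
  have "\<bar>cutoff k x - cutoff k (x + h)\<bar> \<le> \<bar>norm x / (real k + 1) - norm (x + h) / (real k + 1)\<bar>"
  proof -
    have "\<bar>max 0 (min 1 (2 - a)) - max 0 (min 1 (2 - b))\<bar> \<le> \<bar>a - b\<bar>" for a b :: real by auto
    then show ?thesis unfolding cutoff_def .
  qed
  also have "\<dots> = \<bar>norm x - norm (x + h)\<bar> / (real k + 1)"
    by (simp add: diff_divide_distrib[symmetric])
  also have "\<dots> \<le> \<bar>norm x - norm (x + h)\<bar> / 1"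
    by (intro divide_left_mono) auto
  also have "\<dots> \<le> norm h"
    using norm_triangle_ineq3[of x "x + h"] by simp
  finally show ?thesis using cutoff_bounds[of k x] cutoff_bounds[of k "x + h"] by auto
qed

lemma modular_cutoff:
  assumes [measurable]: "u \<in> borel_measurable borel" and "modular u < \<infinity>"
  shows "(\<lambda>k. modular (\<lambda>x. u x - cutoff k x * u x)) \<longlonglongrightarrow> 0"
proof (rule modular_dominated_convergence[OF _ _ _ assms(2)])
  show "\<bar>u x - cutoff k x * u x\<bar> \<le> \<bar>u x\<bar>" for k x
  proof -
    have "\<bar>u x - cutoff k x * u x\<bar> = \<bar>1 - cutoff k x\<bar> * \<bar>u x\<bar>" by (simp add: algebra_simps flip: abs_mult)
    also have "\<dots> \<le> 1 * \<bar>u x\<bar>" using cutoff_bounds[of k x] by (intro mult_right_mono) auto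
    finally show ?thesis by simp
  qed
  show "AE x in lborel. (\<lambda>k. u x - cutoff k x * u x) \<longlonglongrightarrow> 0"
    by (auto intro!: tendsto_eventually eventually_mono[OF eventually_cutoff_eq_1])
qed measurable

text \<open>The product rule for differences splits the quotient of \<open>(1 - cutoff k) * u\<close> into one term
  dominated by the quotient of \<open>u\<close> and one dominated by \<open>step_ratio h * |u (x + h)|\<close>. Integrated over \<open>h\<close> with the
  weight, the modular of the latter is at most \<open>modular u\<close> times the integral of \<open>nn_integral_step_ratio_finite\<close>.\<close>

theorem energy_cutoff:
  assumes [measurable]: "u \<in> borel_measurable borel" and u: "modular u < \<infinity>" "energy u < \<infinity>"
  shows "(\<lambda>k. energy (\<lambda>x. u x - cutoff k x * u x)) \<longlonglongrightarrow> 0"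
proof -
  define w where "w h x = \<bar>quotient u h x\<bar> + step_ratio h * \<bar>u (x + h)\<bar>" for h x
  have [measurable]: "(\<lambda>(h, x). w h x) \<in> borel_measurable (borel \<Otimes>\<^sub>M borel)" "w h \<in> borel_measurable borel" for h
    unfolding w_def by measurable
  have dom: "\<bar>quotient (\<lambda>x. u x - cutoff k x * u x) h x\<bar> \<le> \<bar>w h x\<bar>" for k h x
  proof -
    have "(u x - cutoff k x * u x) - (u (x + h) - cutoff k (x + h) * u (x + h))
      = (1 - cutoff k x) * (u x - u (x + h)) - (cutoff k x - cutoff k (x + h)) * u (x + h)"
      by (simp add: algebra_simps)
    then have "\<bar>(u x - cutoff k x * u x) - (u (x + h) - cutoff k (x + h) * u (x + h))\<bar>
      \<le> \<bar>1 - cutoff k x\<bar> * \<bar>u x - u (x + h)\<bar> + \<bar>cutoff k x - cutoff k (x + h)\<bar> * \<bar>u (x + h)\<bar>"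
      by (simp only: abs_mult[symmetric] abs_triangle_ineq4)
    also have "\<dots> \<le> 1 * \<bar>u x - u (x + h)\<bar> + min 1 (norm h) * \<bar>u (x + h)\<bar>"
      using cutoff_bounds[of k x] by (intro add_mono mult_right_mono cutoff_Lipschitz) auto
    finally have "\<bar>(u x - cutoff k x * u x) - (u (x + h) - cutoff k (x + h) * u (x + h))\<bar> / M (norm h)
      \<le> (1 * \<bar>u x - u (x + h)\<bar> + min 1 (norm h) * \<bar>u (x + h)\<bar>) / M (norm h)"
      by (intro divide_right_mono) (auto simp: M_nonneg)
    also have "\<dots> = w h x"
      by (simp add: w_def quotient_def step_ratio_def M_nonneg add_divide_distrib)
    finally show ?thesis by (simp add: quotient_def M_nonneg)
  qed
  have w_le: "modular (w h) \<le> ennreal \<Delta> * (modular (quotient u h) + ennreal (step_ratio h powr p) * modular u)" for h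
  proof -
    have "modular (w h) \<le> ennreal \<Delta> * (modular (\<lambda>x. \<bar>quotient u h x\<bar>) + modular (\<lambda>x. step_ratio h * \<bar>u (x + h)\<bar>))"
      unfolding w_def by (rule modular_add) measurable
    also have "modular (\<lambda>x. \<bar>quotient u h x\<bar>) = modular (quotient u h)"
      by (simp add: modular_def)
    also have "modular (\<lambda>x. step_ratio h * \<bar>u (x + h)\<bar>) \<le> ennreal (step_ratio h powr p) * modular (\<lambda>x. \<bar>u (x + h)\<bar>)"
      by (intro modular_scale_le step_ratio_nonneg step_ratio_le_1) measurable
    also have "modular (\<lambda>x. \<bar>u (x + h)\<bar>) = modular u"
      using modular_translate[of u h] by (simp add: modular_def)
    finally show ?thesis by (simp add: mult_left_mono add_left_mono)
  qed
  show ?thesis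
  proof (rule energy_tendsto_0[where W = "\<lambda>h. modular (w h)"])
    show "modular (quotient (\<lambda>x. u x - cutoff k x * u x) h) \<le> modular (w h)" for k h
      by (rule modular_mono[OF dom])
    have "(\<integral>\<^sup>+h. weight h * modular (w h) \<partial>lborel)
      \<le> (\<integral>\<^sup>+h. weight h * (ennreal \<Delta> * (modular (quotient u h) + ennreal (step_ratio h powr p) * modular u)) \<partial>lborel)"
      by (intro nn_integral_mono mult_left_mono w_le) auto
    also have "\<dots> = (\<integral>\<^sup>+h. ennreal \<Delta> * (weight h * modular (quotient u h)
          + modular u * (weight h * ennreal (step_ratio h powr p))) \<partial>lborel)"
      by (intro nn_integral_cong) (simp add: distrib_left mult_ac)
    also have "\<dots> = ennreal \<Delta> * (energy u + modular u * (\<integral>\<^sup>+h. weight h * ennreal (step_ratio h powr p) \<partial>lborel))"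
      by (simp add: energy_def nn_integral_add nn_integral_cmult)
    also have "\<dots> < \<infinity>"
      using u nn_integral_step_ratio_finite by (simp add: ennreal_mult_less_top)
    finally show "(\<integral>\<^sup>+h. weight h * modular (w h) \<partial>lborel) < \<infinity>" .
    show "(\<lambda>k. modular (quotient (\<lambda>x. u x - cutoff k x * u x) h)) \<longlonglongrightarrow> 0" if "modular (w h) < \<infinity>" for h
    proof (rule modular_dominated_convergence[OF _ _ dom that])
      show "AE x in lborel. (\<lambda>k. quotient (\<lambda>x. u x - cutoff k x * u x) h x) \<longlonglongrightarrow> 0"
      proof (rule AE_I2)
        fix x
        have "eventually (\<lambda>k. quotient (\<lambda>x. u x - cutoff k x * u x) h x = 0) sequentially"
          using eventually_cutoff_eq_1[of x] eventually_cutoff_eq_1[of "x + h"]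
          by eventually_elim (simp add: quotient_def)
        then show "(\<lambda>k. quotient (\<lambda>x. u x - cutoff k x * u x) h x) \<longlonglongrightarrow> 0"
          by (rule tendsto_eventually)
      qed
    qed measurable
  qed measurable
qed

end

section \<open>Smooth functions and convolution\<close>

text \<open>The way all smoothness is proved here: it suffices to exhibit a set of functions that is closed
  under partial derivatives.\<close>

lemma C_k_closed_under_partials:
  fixes S :: "(real ^ 'n \<Rightarrow> real) set"
  assumes "\<And>f. f \<in> S \<Longrightarrow> \<exists>f'. \<forall>x. (f has_derivative f' x) (at x) \<and> (\<forall>i. (\<lambda>x. f' x (axis i 1)) \<in> S)"
  shows "f \<in> S \<Longrightarrow> C_k k f"
proof (induction k arbitrary: f)
  case 0
  from assms[OF 0] have "f differentiable (at x)" for x by (auto simp: differentiable_def)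
  then show ?case by (auto intro!: continuous_at_imp_continuous_on differentiable_imp_continuous_within)
next
  case (Suc k)
  obtain f' where f': "\<And>x. (f has_derivative f' x) (at x)" "\<And>i. (\<lambda>x. f' x (axis i 1)) \<in> S"
    using assms[OF Suc.prems] by metis
  have "frechet_derivative f (at x) = f' x" for x
    using frechet_derivative_at[OF f'(1)] by simp
  then show ?case
    using f' Suc.IH by (auto simp: differentiable_on_def differentiable_def intro: has_derivative_at_withinI)
qed

text \<open>The family is closed under differentiation up to linear combinations, unlike \<open>exp (- 1 / s)\<close>
  alone, and this is what makes the bump functions built from it manifestly smooth.\<close>

definition flat :: "nat \<Rightarrow> real \<Rightarrow> real" where
  "flat m s = (if 0 < s then exp (- 1 / s) / s ^ m else 0)"

lemma flat_tendsto_0: "(flat m \<longlongrightarrow> 0) (at_right 0)"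
proof -
  have "((\<lambda>x::real. x ^ m / exp x) \<longlongrightarrow> 0) at_top" by (rule tendsto_power_div_exp_0)
  then have "((\<lambda>s::real. inverse s ^ m / exp (inverse s)) \<longlongrightarrow> 0) (at_right 0)"
    by (rule filterlim_compose) (rule filterlim_inverse_at_top_right)
  moreover have "eventually (\<lambda>s. inverse s ^ m / exp (inverse s) = flat m s) (at_right 0)"
    using eventually_at_right_less[of 0]
    by eventually_elim (auto simp: flat_def exp_minus field_simps power_inverse)
  ultimately show ?thesis by (rule Lim_transform_eventually)
qed

lemma has_derivative_flat:
  "(flat m has_real_derivative (flat (m + 2) s - m * flat (m + 1) s)) (at s)"
proof -
  consider "0 < s" | "s < 0" | "s = 0" by linarith
  then show ?thesis
  proof cases
    case 1
    \<comment> \<open>Writing the power as an exponential avoids the case \<open>m = 0\<close> in its derivative.\<close>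
    have flat_eq: "flat m s = exp (- 1 / s - m * ln s)" if "0 < s" for m s
      using that by (simp add: flat_def exp_diff exp_of_nat_mult)
    have "exp (- 1 / s - m * ln s) * (1 / s ^ 2 - m / s) = flat (m + 2) s - m * flat (m + 1) s"
    proof -
      have "e / s ^ m * (1 / s ^ 2 - m / s) = e / s ^ (m + 2) - m * (e / s ^ (m + 1))" for e :: real
        using 1 by (simp add: power_add power2_eq_square diff_divide_distrib right_diff_distrib mult_ac)
      then show ?thesis using 1 by (simp only: flat_eq[OF 1, symmetric]) (simp add: flat_def)
    qed
    moreover have "((\<lambda>s. exp (- 1 / s - m * ln s)) has_real_derivative
        exp (- 1 / s - m * ln s) * (1 / s ^ 2 - m / s)) (at s)"
      using 1 by (auto intro!: derivative_eq_intros simp: power2_eq_square)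
    ultimately have "((\<lambda>s. exp (- 1 / s - m * ln s)) has_real_derivative flat (m + 2) s - m * flat (m + 1) s) (at s)"
      by simp
    then show ?thesis
      by (rule has_field_derivative_transform_within_open[of _ _ _ "{0<..}"]) (use 1 in \<open>simp_all add: flat_eq\<close>)
  next
    case 2
    have "((\<lambda>s. 0) has_real_derivative (flat (m + 2) s - m * flat (m + 1) s)) (at s)"
      using 2 by (simp add: flat_def)
    then show ?thesis
      by (rule has_field_derivative_transform_within_open[of _ _ _ "{..<0}"]) (use 2 in \<open>auto simp: flat_def\<close>)
  next
    case 3
    have "((\<lambda>y. (flat m y - flat m 0) / (y - 0)) \<longlongrightarrow> 0) (at_right 0)"
      using flat_tendsto_0[of "Suc m"]
      by (rule Lim_transform_eventually)
        (auto intro!: eventually_mono[OF eventually_at_right_less[of 0]] simp: flat_def)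
    moreover have "((\<lambda>y. (flat m y - flat m 0) / (y - 0)) \<longlongrightarrow> 0) (at_left 0)"
      by (rule tendsto_eventually) (simp add: flat_def eventually_at_filter)
    ultimately have "((\<lambda>y. (flat m y - flat m 0) / (y - 0)) \<longlongrightarrow> 0) (at 0)"
      by (simp add: filterlim_split_at)
    then show ?thesis
      by (simp add: 3 has_field_derivative_iff flat_def)
  qed
qed

text \<open>The functions obtained from polynomials and the bumps \<open>flat m (d\<^sup>2 - |x|\<^sup>2)\<close> by addition and
  multiplication. The bumps are supported in the ball of radius \<open>d\<close>.\<close>

inductive_set smooth_algebra :: "real \<Rightarrow> (real ^ 'n \<Rightarrow> real) set" for d :: real where
  const: "(\<lambda>x. c) \<in> smooth_algebra d"
| coord: "(\<lambda>x. x $ i) \<in> smooth_algebra d"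
| flat: "(\<lambda>x. flat m (d\<^sup>2 - x \<bullet> x)) \<in> smooth_algebra d"
| add: "f \<in> smooth_algebra d \<Longrightarrow> g \<in> smooth_algebra d \<Longrightarrow> (\<lambda>x. f x + g x) \<in> smooth_algebra d"
| mult: "f \<in> smooth_algebra d \<Longrightarrow> g \<in> smooth_algebra d \<Longrightarrow> (\<lambda>x. f x * g x) \<in> smooth_algebra d"

lemma smooth_algebra_closed_under_partials:
  "f \<in> smooth_algebra d \<Longrightarrow>
    \<exists>f'. \<forall>x. (f has_derivative f' x) (at x) \<and> (\<forall>i. (\<lambda>x. f' x (axis i 1)) \<in> smooth_algebra d)"
proof (induction rule: smooth_algebra.induct)
  case (const c)
  show ?case by (intro exI[of _ "\<lambda>x h. 0"]) (auto intro: smooth_algebra.const)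
next
  case (coord j)
  show ?case
    by (intro exI[of _ "\<lambda>x h. h $ j"])
      (auto intro!: smooth_algebra.const bounded_linear_imp_has_derivative bounded_linear_vec_nth)
next
  case (flat m)
  let ?D = "\<lambda>x::real^'n. flat (m + 2) (d\<^sup>2 - x \<bullet> x) + (- real m) * flat (m + 1) (d\<^sup>2 - x \<bullet> x)"
  have "((\<lambda>x. flat m (d\<^sup>2 - x \<bullet> x)) has_derivative (\<lambda>h. ?D x * (- 2 * (x \<bullet> h)))) (at x)" for x :: "real^'n"
  proof -
    have "((\<lambda>x. d\<^sup>2 - x \<bullet> x) has_derivative (\<lambda>h. - 2 * (x \<bullet> h))) (at x)"
      by (auto intro!: derivative_eq_intros simp: inner_commute)
    from has_derivative_compose[OF this has_derivative_flat[unfolded has_field_derivative_def]]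
    show ?thesis by (simp add: algebra_simps)
  qed
  moreover have "(\<lambda>x. ?D x * (- 2 * (x \<bullet> axis i 1))) \<in> smooth_algebra d" for i
    unfolding inner_axis inner_real_def mult_1_right by (intro smooth_algebra.intros)
  ultimately show ?case
    by (intro exI[of _ "\<lambda>x h. ?D x * (- 2 * (x \<bullet> h))"] allI conjI)
next
  case (add f g)
  then obtain f' g' where "\<And>x. (f has_derivative f' x) (at x)" "\<And>i. (\<lambda>x. f' x (axis i 1)) \<in> smooth_algebra d"
    "\<And>x. (g has_derivative g' x) (at x)" "\<And>i. (\<lambda>x. g' x (axis i 1)) \<in> smooth_algebra d"
    by metis
  then show ?case
    by (intro exI[of _ "\<lambda>x h. f' x h + g' x h"]) (auto intro!: smooth_algebra.intros has_derivative_add)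
next
  case (mult f g)
  then obtain f' g' where "\<And>x. (f has_derivative f' x) (at x)" "\<And>i. (\<lambda>x. f' x (axis i 1)) \<in> smooth_algebra d"
    "\<And>x. (g has_derivative g' x) (at x)" "\<And>i. (\<lambda>x. g' x (axis i 1)) \<in> smooth_algebra d"
    by metis
  then show ?case using mult.hyps
    by (intro exI[of _ "\<lambda>x h. f x * g' x h + f' x h * g x"]) (auto intro!: smooth_algebra.intros has_derivative_mult)
qed

lemma smooth_algebra_C_k: "f \<in> smooth_algebra d \<Longrightarrow> C_k k f"
  by (rule C_k_closed_under_partials[OF smooth_algebra_closed_under_partials])

lemma compact_closure_supportI:
  fixes f :: "'a::euclidean_space \<Rightarrow> real"
  assumes "\<And>x. R < norm x \<Longrightarrow> f x = 0"
  shows "compact (closure {x. f x \<noteq> 0})"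
proof -
  have "{x. f x \<noteq> 0} \<subseteq> cball 0 R" using assms by (auto simp: not_less[symmetric])
  then show ?thesis using bounded_subset[OF bounded_cball] by (simp add: compact_closure)
qed

lemma Cc_infinity_support:
  assumes "f \<in> Cc_infinity"
  obtains R where "\<And>x. R < norm x \<Longrightarrow> f x = 0"
proof -
  have "bounded (closure {x. f x \<noteq> 0})"
    using assms by (auto simp: Cc_infinity_def compact_imp_bounded)
  then obtain R where "\<forall>x \<in> closure {x. f x \<noteq> 0}. norm x \<le> R" by (auto simp: bounded_iff)
  then have "f x = 0" if "R < norm x" for x
    using that closure_subset[of "{x. f x \<noteq> 0}"] by (auto simp: subset_iff not_less[symmetric])
  then show ?thesis by (rule that)
qed

text \<open>Normalise the bump \<open>flat 0 (d\<^sup>2 - |x|\<^sup>2)\<close>, which is positive exactly on the open ball of radius \<open>d\<close>.\<close>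

theorem mollifier_exists:
  assumes "0 < d"
  obtains \<rho> :: "real ^ 'n \<Rightarrow> real" where "\<rho> \<in> Cc_infinity" "\<And>x. 0 \<le> \<rho> x" "\<And>x. \<rho> (- x) = \<rho> x"
    "\<And>x. d \<le> norm x \<Longrightarrow> \<rho> x = 0" "(\<integral>\<^sup>+x. ennreal (\<rho> x) \<partial>lborel) = 1"
proof -
  define b where "b x = flat 0 (d\<^sup>2 - x \<bullet> x)" for x :: "real^'n"
  have b_S: "b \<in> smooth_algebra d" unfolding b_def by (rule smooth_algebra.flat)
  have b0: "0 \<le> b x" "b x \<le> 1" for x by (auto simp: b_def flat_def)
  have supp: "b x \<noteq> 0 \<longleftrightarrow> x \<in> ball 0 d" for x
    using assms by (auto simp: b_def flat_def norm_lt_square power2_eq_square power2_norm_eq_inner[symmetric])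
  have supp0: "b x = 0" if "d \<le> norm x" for x
    using supp[of x] that by auto
  have "continuous_on UNIV b" using smooth_algebra_C_k[OF b_S, of 0] by simp
  then have [measurable]: "b \<in> borel_measurable borel" by (rule borel_measurable_continuous_onI)
  define J where "J = (\<integral>\<^sup>+x. ennreal (b x) \<partial>lborel)"
  have "J \<le> (\<integral>\<^sup>+x. indicator (ball (0::real^'n) d) x \<partial>lborel)"
    unfolding J_def
  proof (rule nn_integral_mono)
    fix x :: "real^'n"
    show "ennreal (b x) \<le> indicator (ball 0 d) x"
      using b0[of x] supp[of x] by (auto simp: indicator_def ennreal_le_1)
  qed
  also have "\<dots> < \<infinity>" using emeasure_bounded_finite[of "ball (0::real^'n) d"] by simp
  finally have J_fin: "J < \<infinity>" .
  have "J \<noteq> 0"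
  proof
    assume "J = 0"
    then have "AE x in lborel. b x = 0"
      using b0 unfolding J_def by (subst (asm) nn_integral_0_iff_AE) (auto simp: antisym)
    then have "AE x in lborel. x \<notin> ball (0::real^'n) d"
      by eventually_elim (use supp in blast)
    then have "emeasure lborel (ball (0::real^'n) d) = 0"
      by (subst (asm) AE_iff_measurable[OF _ refl]) (auto simp: ball_def)
    then show False using assms content_ball_pos[of d "0::real^'n"] by (simp add: measure_def)
  qed
  then obtain j where j: "J = ennreal j" "0 < j"
    using J_fin by (cases J) auto
  show ?thesis
  proof (rule that[of "\<lambda>x. (1 / j) * b x"])
    show "(\<lambda>x. 1 / j * b x) \<in> Cc_infinity"
      unfolding Cc_infinity_def
    proof (intro CollectI conjI allI)
      show "C_k k (\<lambda>x. 1 / j * b x)" for k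
        by (rule smooth_algebra_C_k[of _ d]) (intro smooth_algebra.mult smooth_algebra.const b_S)
      show "compact (closure {x. 1 / j * b x \<noteq> 0})"
        using supp0 by (intro compact_closure_supportI[of d]) auto
    qed
    show "(\<integral>\<^sup>+x. ennreal (1 / j * b x) \<partial>lborel) = 1"
    proof -
      have "(\<integral>\<^sup>+x. ennreal (1 / j * b x) \<partial>lborel) = (\<integral>\<^sup>+x. ennreal (1 / j) * ennreal (b x) \<partial>lborel)"
        using b0 by (simp only: ennreal_mult'')
      also have "\<dots> = ennreal (1 / j) * J" unfolding J_def by (rule nn_integral_cmult) measurable
      also have "\<dots> = 1" using j by (simp flip: ennreal_mult)
      finally show ?thesis .
    qed
    show "1 / j * b x = 0" if "d \<le> norm x" for x using supp0[OF that] by simp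
    show "0 \<le> 1 / j * b x" for x using j b0 by simp
    show "1 / j * b (- x) = 1 / j * b x" for x by (simp add: b_def)
  qed
qed

lemma Cc_infinity_derivatives:
  fixes f :: "real ^ 'n \<Rightarrow> real"
  assumes "f \<in> Cc_infinity"
  obtains f' where "\<And>x. (f has_derivative f' x) (at x)" "\<And>i. (\<lambda>x. f' x (axis i 1)) \<in> Cc_infinity"
proof -
  define f' where "f' x = frechet_derivative f (at x)" for x
  have C: "C_k k f" for k using assms by (simp add: Cc_infinity_def)
  have der: "(f has_derivative f' x) (at x)" for x
    using C[of "Suc 0"] unfolding f'_def
    by (auto simp: frechet_derivative_works[symmetric] differentiable_on_def)
  obtain R where R: "\<And>x. R < norm x \<Longrightarrow> f x = 0" using Cc_infinity_support[OF assms] by blast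
  have "f' x = (\<lambda>h. 0)" if "R < norm x" for x
  proof -
    have "open {x :: real^'n. R < norm x}" by (intro open_Collect_less continuous_intros)
    then have "(f has_derivative (\<lambda>h. 0)) (at x)"
      using that R by (intro has_derivative_transform_within_open[OF has_derivative_const]) auto
    with der show ?thesis by (rule has_derivative_unique)
  qed
  then have "compact (closure {x. f' x (axis i 1) \<noteq> 0})" for i
    by (intro compact_closure_supportI[of R]) simp
  moreover have "C_k k (\<lambda>x. f' x (axis i 1))" for i k
    using C[of "Suc k"] by (simp add: f'_def)
  ultimately show ?thesis
    using that[OF der] by (simp add: Cc_infinity_def)
qed

lemma Cc_infinity_continuous: "f \<in> Cc_infinity \<Longrightarrow> continuous_on UNIV f"
  by (auto simp: Cc_infinity_def dest: spec[of _ 0])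

lemma Cc_infinity_measurable: "f \<in> Cc_infinity \<Longrightarrow> f \<in> borel_measurable borel"
  by (intro borel_measurable_continuous_onI Cc_infinity_continuous)

lemma Cc_infinity_bounded:
  fixes f :: "real ^ 'n \<Rightarrow> real"
  assumes "f \<in> Cc_infinity"
  obtains B where "0 \<le> B" "\<And>x. \<bar>f x\<bar> \<le> B"
proof -
  obtain R where R: "\<And>x. R < norm x \<Longrightarrow> f x = 0" using Cc_infinity_support[OF assms] by blast
  have "compact (f ` cball 0 R)"
    using Cc_infinity_continuous[OF assms] by (intro compact_continuous_image) (auto intro: continuous_on_subset)
  then obtain B where B: "\<forall>x\<in>cball 0 R. \<bar>f x\<bar> \<le> B"
    using compact_imp_bounded by (fastforce simp: bounded_iff)
  show ?thesis
  proof (rule that[of "max B 0"])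
    show "\<bar>f x\<bar> \<le> max B 0" for x
    proof (cases "norm x \<le> R")
      case True
      then have "\<bar>f x\<bar> \<le> B" using B by simp
      then show ?thesis by simp
    qed (use R in auto)
  qed auto
qed

text \<open>The partial derivatives are again continuous with compact support, hence bounded, and so is the
  total derivative.\<close>

lemma Cc_infinity_Lipschitz:
  fixes f :: "real ^ 'n \<Rightarrow> real"
  assumes "f \<in> Cc_infinity"
  obtains B where "0 \<le> B" "\<And>x y. \<bar>f x - f y\<bar> \<le> B * norm (x - y)"
    "\<And>f' x h. (f has_derivative f') (at x) \<Longrightarrow> \<bar>f' h\<bar> \<le> B * norm h"
proof -
  obtain f' where f': "\<And>x. (f has_derivative f' x) (at x)" "\<And>i. (\<lambda>x. f' x (axis i 1)) \<in> Cc_infinity"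
    using Cc_infinity_derivatives[OF assms] by blast
  have "\<exists>B. \<forall>x. \<bar>f' x (axis i 1)\<bar> \<le> B \<and> 0 \<le> B" for i
    using Cc_infinity_bounded[OF f'(2)] by metis
  then obtain b where b: "\<And>i x. \<bar>f' x (axis i 1)\<bar> \<le> b i" "\<And>i. 0 \<le> b i" by metis
  define B where "B = (\<Sum>i\<in>UNIV. b i)"
  have *: "\<bar>f' x h\<bar> \<le> B * norm h" for x h
  proof -
    interpret linear "f' x" using f'(1)[of x] by (rule has_derivative_linear)
    have "f' x h = f' x (\<Sum>i\<in>UNIV. h $ i *\<^sub>R axis i 1)"
      using basis_expansion[of h] by (simp add: scalar_mult_eq_scaleR)
    also have "\<dots> = (\<Sum>i\<in>UNIV. h $ i * f' x (axis i 1))" by (simp add: sum scale)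
    also have "\<bar>\<dots>\<bar> \<le> (\<Sum>i\<in>UNIV. \<bar>h $ i * f' x (axis i 1)\<bar>)" by (rule sum_abs)
    also have "\<dots> \<le> (\<Sum>i\<in>UNIV. norm h * b i)"
      unfolding abs_mult by (intro sum_mono mult_mono b component_le_norm_cart) auto
    finally show ?thesis by (simp add: B_def sum_distrib_left mult.commute)
  qed
  show ?thesis
  proof (rule that[of B])
    show "0 \<le> B" by (simp add: B_def sum_nonneg b)
    show "\<bar>f x - f y\<bar> \<le> B * norm (x - y)" for x y
    proof -
      have "norm (f x - f y) \<le> B * norm (x - y)"
        by (rule differentiable_bound[of UNIV f f'])
          (auto intro!: onorm_le simp: f'(1) *)
      then show ?thesis by simp
    qed
    show "\<bar>g h\<bar> \<le> B * norm h" if "(f has_derivative g) (at x)" for g x h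
      using has_derivative_unique[OF that f'(1)] * by simp
  qed
qed

definition convolution :: "('a::euclidean_space \<Rightarrow> real) \<Rightarrow> ('a \<Rightarrow> real) \<Rightarrow> 'a \<Rightarrow> real" where
  "convolution f u x = (\<integral>y. f (x - y) * u y \<partial>lborel)"

lemma integrable_bounded_mult:
  fixes u :: "'a::euclidean_space \<Rightarrow> real"
  assumes "integrable lborel u" "f \<in> borel_measurable borel" "\<And>x. \<bar>f x\<bar> \<le> B"
  shows "integrable lborel (\<lambda>y. f y * u y)"
proof (rule Bochner_Integration.integrable_bound)
  show "integrable lborel (\<lambda>y. B * \<bar>u y\<bar>)" using assms(1) by simp
  show "AE x in lborel. norm (f x * u x) \<le> norm (B * \<bar>u x\<bar>)"
    using assms(3) by (auto simp: abs_mult intro!: mult_right_mono order_trans[OF assms(3) abs_ge_self])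
qed (use assms in measurable)

text \<open>Differentiation under the integral sign: the remainder of the first-order expansion of \<open>f\<close>,
  divided by the length of the increment, tends to zero pointwise and is bounded by twice the
  Lipschitz constant of \<open>f\<close>, so dominated convergence against the integrable function \<open>u\<close> applies.\<close>

lemma has_derivative_convolution:
  fixes f :: "real ^ 'n \<Rightarrow> real"
  assumes f: "f \<in> Cc_infinity" and f': "\<And>x. (f has_derivative f' x) (at x)"
    and f'_Cc: "\<And>i. (\<lambda>x. f' x (axis i 1)) \<in> Cc_infinity" and u: "integrable lborel u"
  shows "(convolution f u has_derivative
    (\<lambda>h. \<Sum>i\<in>UNIV. h $ i * convolution (\<lambda>x. f' x (axis i 1)) u x)) (at x)"
proof -
  note [measurable] = Cc_infinity_measurable[OF f] Cc_infinity_measurable[OF f'_Cc]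
  have [measurable]: "u \<in> borel_measurable borel" using u by auto
  let ?L = "\<lambda>h. \<Sum>i\<in>UNIV. h $ i * convolution (\<lambda>x. f' x (axis i 1)) u x"
  obtain B where B: "0 \<le> B" "\<And>x y. \<bar>f x - f y\<bar> \<le> B * norm (x - y)" "\<And>x h. \<bar>f' x h\<bar> \<le> B * norm h"
    using Cc_infinity_Lipschitz[OF f] f' by metis
  have int_f: "integrable lborel (\<lambda>y. f (z - y) * u y)" for z
  proof -
    obtain C where "\<And>x. \<bar>f x\<bar> \<le> C" using Cc_infinity_bounded[OF f] by metis
    then show ?thesis by (intro integrable_bounded_mult[OF u, where B = C]) auto
  qed
  have int_f': "integrable lborel (\<lambda>y. f' (z - y) (axis i 1) * u y)" for z i
  proof -
    obtain C where "\<And>x. \<bar>f' x (axis i 1)\<bar> \<le> C" using Cc_infinity_bounded[OF f'_Cc] by metis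
    then show ?thesis by (intro integrable_bounded_mult[OF u, where B = C]) auto
  qed
  have expand: "f' z h = (\<Sum>i\<in>UNIV. h $ i * f' z (axis i 1))" for z h
  proof -
    interpret linear "f' z" using f'[of z] by (rule has_derivative_linear)
    have "f' z h = f' z (\<Sum>i\<in>UNIV. h $ i *\<^sub>R axis i 1)"
      using basis_expansion[of h] by (simp add: scalar_mult_eq_scaleR)
    also have "\<dots> = (\<Sum>i\<in>UNIV. h $ i * f' z (axis i 1))" by (simp add: sum scale)
    finally show ?thesis .
  qed
  have L: "?L h = (\<integral>y. f' (x - y) h * u y \<partial>lborel)" for h
  proof -
    have "(\<integral>y. f' (x - y) h * u y \<partial>lborel) = (\<integral>y. (\<Sum>i\<in>UNIV. h $ i * (f' (x - y) (axis i 1) * u y)) \<partial>lborel)"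
      by (subst expand) (simp add: sum_distrib_right mult.assoc)
    also have "\<dots> = ?L h"
      by (subst Bochner_Integration.integral_sum) (auto simp: convolution_def int_f')
    finally show ?thesis ..
  qed
  have int_L: "integrable lborel (\<lambda>y. f' (x - y) h * u y)" for h
    by (subst expand) (simp add: sum_distrib_right mult.assoc int_f')
  let ?r = "\<lambda>h y. (f (x + h - y) - f (x - y) - f' (x - y) h) / norm h"
  have quot: "(convolution f u (x + h) - convolution f u x - ?L h) / norm h = (\<integral>y. ?r h y * u y \<partial>lborel)" for h
  proof -
    have "(\<integral>y. ?r h y * u y \<partial>lborel) = (\<integral>y. (f (x + h - y) * u y - f (x - y) * u y - f' (x - y) h * u y) / norm h \<partial>lborel)"
      by (intro Bochner_Integration.integral_cong) (auto simp: field_simps)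
    also have "\<dots> = (convolution f u (x + h) - convolution f u x - ?L h) / norm h"
      by (subst L) (simp add: convolution_def int_f int_L)
    finally show ?thesis ..
  qed
  have "((\<lambda>h. (convolution f u (x + h) - convolution f u x - ?L h) / norm h) \<longlongrightarrow> 0) (at 0)"
    unfolding tendsto_at_iff_sequentially quot
  proof (intro allI impI)
    fix H :: "nat \<Rightarrow> real^'n" assume H: "\<forall>i. H i \<in> UNIV - {0}" "H \<longlonglongrightarrow> 0"
    have "(\<lambda>k. \<integral>y. ?r (H k) y * u y \<partial>lborel) \<longlonglongrightarrow> (\<integral>y. 0 \<partial>(lborel :: (real^'n) measure))"
    proof (rule integral_dominated_convergence[where w = "\<lambda>y. 2 * B * \<bar>u y\<bar>"])
      show "(\<lambda>y. ?r (H k) y * u y) \<in> borel_measurable lborel" for k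
        by (subst expand) measurable
      show "AE y in lborel. norm (?r (H k) y * u y) \<le> 2 * B * \<bar>u y\<bar>" for k
      proof (rule AE_I2)
        fix y
        have "\<bar>f (x + H k - y) - f (x - y) - f' (x - y) (H k)\<bar>
          \<le> \<bar>f (x + H k - y) - f (x - y)\<bar> + \<bar>f' (x - y) (H k)\<bar>" by (rule abs_triangle_ineq4)
        also have "\<dots> \<le> B * norm (H k) + B * norm (H k)"
          using B(2)[of "x + H k - y" "x - y"] B(3) by (intro add_mono) auto
        finally have "\<bar>?r (H k) y\<bar> \<le> 2 * B"
          using H(1) by (simp add: field_simps)
        then show "norm (?r (H k) y * u y) \<le> 2 * B * \<bar>u y\<bar>"
          unfolding real_norm_def abs_mult by (rule mult_right_mono) simp
      qed
      show "AE y in lborel. (\<lambda>k. ?r (H k) y * u y) \<longlonglongrightarrow> 0"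
      proof (rule AE_I2)
        fix y
        have "((\<lambda>h. norm (f (x - y + h) - f (x - y) - f' (x - y) h) / norm h) \<longlongrightarrow> 0) (at 0)"
          using f'[of "x - y"] by (simp add: has_derivative_at)
        then have "(\<lambda>k. norm (f (x - y + H k) - f (x - y) - f' (x - y) (H k)) / norm (H k)) \<longlonglongrightarrow> 0"
          using H by (auto simp: tendsto_at_iff_sequentially o_def)
        then have "(\<lambda>k. norm (?r (H k) y)) \<longlonglongrightarrow> 0"
          by (simp add: algebra_simps)
        then have "(\<lambda>k. ?r (H k) y) \<longlonglongrightarrow> 0" by (rule tendsto_norm_zero_cancel)
        then show "(\<lambda>k. ?r (H k) y * u y) \<longlonglongrightarrow> 0" by (rule tendsto_mult_left_zero)
      qed
    qed (use u in auto)
    then show "((\<lambda>h. \<integral>y. ?r h y * u y \<partial>lborel) \<circ> H) \<longlonglongrightarrow> 0" by (simp add: o_def)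
  qed
  then have "((\<lambda>h. norm (convolution f u (x + h) - convolution f u x - ?L h) / norm h) \<longlongrightarrow> 0) (at 0)"
    using tendsto_norm_zero by fastforce
  moreover have "bounded_linear ?L"
    by (intro bounded_linear_sum bounded_linear_mult_const bounded_linear_vec_nth)
  ultimately show ?thesis
    by (simp only: has_derivative_at)
qed

text \<open>The convolutions of \<open>u\<close> with all test functions form a set closed under partial derivatives.\<close>

theorem convolution_Cc_infinity:
  fixes f :: "real ^ 'n \<Rightarrow> real"
  assumes f: "f \<in> Cc_infinity" and u: "integrable lborel u" and supp: "\<And>x. R < norm x \<Longrightarrow> u x = 0"
  shows "convolution f u \<in> Cc_infinity"
  unfolding Cc_infinity_def
proof (intro CollectI conjI allI)
  show "C_k k (convolution f u)" for k
  proof (rule C_k_closed_under_partials[of "(\<lambda>f. convolution f u) ` Cc_infinity"])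
    fix c assume "c \<in> (\<lambda>f. convolution f u) ` Cc_infinity"
    then obtain f where f: "f \<in> Cc_infinity" and c: "c = convolution f u" by auto
    obtain f' where f': "\<And>x. (f has_derivative f' x) (at x)" "\<And>i. (\<lambda>x. f' x (axis i 1)) \<in> Cc_infinity"
      using Cc_infinity_derivatives[OF f] by blast
    have "(\<Sum>j\<in>UNIV. axis i 1 $ j * convolution (\<lambda>x. f' x (axis j 1)) u x)
        = convolution (\<lambda>x. f' x (axis i 1)) u x" for i x
      by (simp add: axis_def if_distrib[of "\<lambda>a. a * _"] cong: if_cong)
    then show "\<exists>c'. \<forall>x. (c has_derivative c' x) (at x) \<and>
        (\<forall>i. (\<lambda>x. c' x (axis i 1)) \<in> (\<lambda>f. convolution f u) ` Cc_infinity)"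
      unfolding c using has_derivative_convolution[OF f f' u] f'(2)
      by (intro exI[of _ "\<lambda>x h. \<Sum>j\<in>UNIV. h $ j * convolution (\<lambda>x. f' x (axis j 1)) u x"]) auto
  qed (use f in auto)
  obtain S where S: "\<And>x. S < norm x \<Longrightarrow> f x = 0" using Cc_infinity_support[OF f] by blast
  show "compact (closure {x. convolution f u x \<noteq> 0})"
  proof (rule compact_closure_supportI)
    fix x :: "real ^ 'n" assume x: "R + S < norm x"
    have "f (x - y) * u y = 0" for y
      using S[of "x - y"] supp[of y] norm_triangle_ineq2[of x y] x by (cases "R < norm y") auto
    then show "convolution f u x = 0" unfolding convolution_def by (simp only: integral_zero)
  qed
qed

section \<open>Mollification and modulars\<close>

text \<open>Sequential continuity at the origin, in the form needed for a mollifier supported in a small ball.\<close>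

lemma small_near_0:
  fixes T :: "'a::real_normed_vector \<Rightarrow> ennreal" and e :: real
  assumes T: "\<And>Z. Z \<longlonglongrightarrow> 0 \<Longrightarrow> (\<lambda>k. T (Z k)) \<longlonglongrightarrow> 0" and "0 < e"
  obtains d where "0 < d" "\<And>z. norm z < d \<Longrightarrow> T z \<le> ennreal e"
proof -
  have "\<exists>d>0. \<forall>z. norm z < d \<longrightarrow> T z \<le> ennreal e"
  proof (rule ccontr)
    assume "\<not> ?thesis"
    then have "\<exists>z. norm z < 1 / Suc k \<and> \<not> T z \<le> ennreal e" for k
      by (metis of_nat_0_less_iff zero_less_Suc zero_less_divide_1_iff)
    then obtain Z where Z: "\<And>k. norm (Z k) < 1 / Suc k" "\<And>k. \<not> T (Z k) \<le> ennreal e"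
      by metis
    have "Z \<longlonglongrightarrow> 0"
      by (rule Lim_null_comparison[OF _ LIMSEQ_Suc[OF lim_1_over_n]]) (intro always_eventually allI less_imp_le Z(1))
    from eventually_happens[OF eventually_less_ennreal[OF T[OF this] \<open>0 < e\<close>]] Z(2) show False
      by (auto simp: not_le dest: less_asym)
  qed
  then show ?thesis using that by blast
qed

lemma
  fixes g :: "'a::euclidean_space \<Rightarrow> real"
  assumes [measurable]: "g \<in> borel_measurable borel"
  shows lborel_integral_translate: "(\<integral>z. g (x + z) \<partial>lborel) = (\<integral>y. g y \<partial>lborel)"
    and lborel_integrable_translate: "integrable lborel (\<lambda>z. g (x + z)) \<longleftrightarrow> integrable lborel g"
proof -
  show "(\<integral>z. g (x + z) \<partial>lborel) = (\<integral>y. g y \<partial>lborel)"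
    by (subst (2) lborel_distr_plus[of x, symmetric]) (simp add: integral_distr)
  show "integrable lborel (\<lambda>z. g (x + z)) \<longleftrightarrow> integrable lborel g"
    by (subst (2) lborel_distr_plus[of x, symmetric]) (simp add: integrable_distr_eq)
qed

locale mollifier =
  fixes \<rho> :: "'a::euclidean_space \<Rightarrow> real"
  assumes mollifier_measurable [measurable]: "\<rho> \<in> borel_measurable borel"
    and mollifier_nonneg: "\<And>z. 0 \<le> \<rho> z"
    and mollifier_integral: "(\<integral>\<^sup>+z. ennreal (\<rho> z) \<partial>lborel) = 1"
begin

text \<open>For even \<open>\<rho>\<close> this is the convolution with \<open>\<rho>\<close>, written as an average of translates.\<close>

definition average :: "('a \<Rightarrow> real) \<Rightarrow> 'a \<Rightarrow> real" where
  "average f x = (\<integral>z. \<rho> z * f (x + z) \<partial>lborel)"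

lemma integrable_mollifier: "integrable lborel \<rho>"
  using mollifier_nonneg mollifier_integral by (intro integrableI_nonneg) auto

lemma mollifier_integral_eq: "(\<integral>z. \<rho> z \<partial>lborel) = 1"
  using mollifier_nonneg mollifier_integral by (simp add: integral_eq_nn_integral)

lemma measurable_average [measurable]:
  assumes [measurable]: "f \<in> borel_measurable borel"
  shows "average f \<in> borel_measurable borel"
  unfolding average_def by measurable

lemma nn_integral_mollifier_le:
  assumes "\<And>z. \<rho> z \<noteq> 0 \<Longrightarrow> T z \<le> e"
  shows "(\<integral>\<^sup>+z. ennreal (\<rho> z) * T z \<partial>lborel) \<le> e"
proof -
  have "(\<integral>\<^sup>+z. ennreal (\<rho> z) * T z \<partial>lborel) \<le> (\<integral>\<^sup>+z. ennreal (\<rho> z) * e \<partial>lborel)"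
  proof (rule nn_integral_mono)
    fix z show "ennreal (\<rho> z) * T z \<le> ennreal (\<rho> z) * e"
      using assms[of z] by (cases "\<rho> z = 0") (auto intro: mult_left_mono)
  qed
  also have "\<dots> = e" by (simp add: nn_integral_multc mollifier_integral)
  finally show ?thesis .
qed

end

context young
begin

text \<open>Jensen's inequality for the probability measure with density \<open>\<rho>\<close>. Where \<open>G \<circ> f\<close> is not integrable
  for it, the right-hand side is infinite.\<close>

lemma Jensen_mollifier:
  fixes f :: "'a::euclidean_space \<Rightarrow> real"
  assumes "mollifier \<rho>" and [measurable]: "f \<in> borel_measurable borel"
    and int: "integrable lborel (\<lambda>z. \<rho> z * f z)"
  shows "ennreal (G (\<integral>z. \<rho> z * f z \<partial>lborel)) \<le> (\<integral>\<^sup>+z. ennreal (\<rho> z) * ennreal (G (f z)) \<partial>lborel)"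
proof -
  interpret mollifier \<rho> by fact
  define P where "P = density lborel (\<lambda>z. ennreal (\<rho> z))"
  interpret P: prob_space P
    by (rule prob_spaceI) (simp add: P_def emeasure_density mollifier_integral)
  have nn: "(\<integral>\<^sup>+z. ennreal (G (f z)) \<partial>P) = (\<integral>\<^sup>+z. ennreal (\<rho> z) * ennreal (G (f z)) \<partial>lborel)"
    unfolding P_def by (rule nn_integral_density) measurable
  show ?thesis
  proof (cases "(\<integral>\<^sup>+z. ennreal (G (f z)) \<partial>P) < \<infinity>")
    case True
    have meas: "f \<in> borel_measurable P" "(\<lambda>z. G (f z)) \<in> borel_measurable P" by (auto simp: P_def)
    have "integrable P f"
      using int mollifier_nonneg by (simp add: P_def integrable_real_density)
    moreover have intG: "integrable P (\<lambda>z. G (f z))"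
      using True meas by (intro integrableI_nonneg) auto
    ultimately have "G (P.expectation f) \<le> P.expectation (\<lambda>z. G (f z))"
      using convex_G by (intro P.jensens_inequality[where I = UNIV]) auto
    moreover have "P.expectation f = (\<integral>z. \<rho> z * f z \<partial>lborel)"
      using mollifier_nonneg by (simp add: P_def integral_real_density)
    ultimately have "ennreal (G (\<integral>z. \<rho> z * f z \<partial>lborel)) \<le> ennreal (P.expectation (\<lambda>z. G (f z)))"
      by (simp add: ennreal_leI)
    also have "\<dots> = (\<integral>\<^sup>+z. ennreal (G (f z)) \<partial>P)"
      using intG by (simp add: nn_integral_eq_integral)
    finally show ?thesis by (simp add: nn)
  qed (simp add: nn[symmetric] not_less top_unique)
qed

text \<open>As \<open>\<rho>\<close> has integral one, \<open>f - average f\<close> is the \<open>\<rho>\<close>-average of \<open>f x - f (x + z)\<close>. Apply Jensen's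
  inequality for each \<open>x\<close> and exchange the integrals.\<close>

theorem modular_average_le:
  fixes f :: "'a::euclidean_space \<Rightarrow> real"
  assumes \<rho>: "mollifier \<rho>" and [measurable]: "f \<in> borel_measurable borel"
    and int: "\<And>x. integrable lborel (\<lambda>z. \<rho> z * f (x + z))"
  shows "modular (\<lambda>x. f x - mollifier.average \<rho> f x)
    \<le> (\<integral>\<^sup>+z. ennreal (\<rho> z) * modular (\<lambda>x. f (x + z) - f x) \<partial>lborel)"
proof -
  interpret mollifier \<rho> by fact
  have "modular (\<lambda>x. f x - average f x) \<le>
    (\<integral>\<^sup>+x. (\<integral>\<^sup>+z. ennreal (\<rho> z) * ennreal (G (f (x + z) - f x)) \<partial>lborel) \<partial>lborel)"
    unfolding modular_def
  proof (rule nn_integral_mono)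
    fix x
    have "integrable lborel (\<lambda>z. \<rho> z * (f (x + z) - f x))"
      using int integrable_mollifier by (simp add: right_diff_distrib)
    from Jensen_mollifier[OF \<rho> _ this]
    have "ennreal (G (\<integral>z. \<rho> z * (f (x + z) - f x) \<partial>lborel))
        \<le> (\<integral>\<^sup>+z. ennreal (\<rho> z) * ennreal (G (f (x + z) - f x)) \<partial>lborel)" by simp
    also have "(\<integral>z. \<rho> z * (f (x + z) - f x) \<partial>lborel) = - (f x - average f x)"
      using int integrable_mollifier by (simp add: right_diff_distrib average_def mollifier_integral_eq)
    finally show "ennreal (G (f x - average f x))
        \<le> (\<integral>\<^sup>+z. ennreal (\<rho> z) * ennreal (G (f (x + z) - f x)) \<partial>lborel)"
      by (simp only: G_even)
  qed
  also have "\<dots> = (\<integral>\<^sup>+z. (\<integral>\<^sup>+x. ennreal (\<rho> z) * ennreal (G (f (x + z) - f x)) \<partial>lborel) \<partial>lborel)"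
    by (rule lborel_pair.Fubini') measurable
  also have "\<dots> = (\<integral>\<^sup>+z. ennreal (\<rho> z) * modular (\<lambda>x. f (x + z) - f x) \<partial>lborel)"
    by (simp add: nn_integral_cmult modular_def)
  finally show ?thesis .
qed

lemma integrable_bounded_support:
  fixes u :: "'a::euclidean_space \<Rightarrow> real"
  assumes [measurable]: "u \<in> borel_measurable borel" and fin: "modular u < \<infinity>"
    and supp: "\<And>x. R < norm x \<Longrightarrow> u x = 0"
  shows "integrable lborel u"
proof (rule integrableI_bounded)
  have "(\<integral>\<^sup>+x. ennreal (norm (u x)) \<partial>lborel) \<le> (\<integral>\<^sup>+x. indicator (cball 0 R) x + ennreal (G (u x)) \<partial>lborel)"
  proof (rule nn_integral_mono)
    fix x show "ennreal (norm (u x)) \<le> indicator (cball 0 R) x + ennreal (G (u x))"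
    proof (cases "norm x \<le> R")
      case True
      have "ennreal (norm (u x)) \<le> ennreal (1 + G (u x))" using abs_le_G[of "u x"] by (intro ennreal_leI) simp
      then show ?thesis using True by simp
    qed (use supp in auto)
  qed
  also have "\<dots> = emeasure lborel (cball (0::'a) R) + modular u"
    by (simp add: nn_integral_add modular_def)
  also have "\<dots> < \<infinity>"
    using fin emeasure_bounded_finite[of "cball (0::'a) R"] by simp
  finally show "(\<integral>\<^sup>+x. ennreal (norm (u x)) \<partial>lborel) < \<infinity>" .
qed simp

lemma modular_divide_le:
  fixes w :: "'a::euclidean_space \<Rightarrow> real"
  assumes [measurable]: "w \<in> borel_measurable borel" and "0 < c" "c \<le> 1"
  shows "modular (\<lambda>x. w x / c) \<le> ennreal ((1 / c) powr q) * modular w"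
proof -
  have "modular (\<lambda>x. w x / c) \<le> (\<integral>\<^sup>+x. ennreal ((1 / c) powr q) * ennreal (G (w x)) \<partial>lborel)"
    unfolding modular_def using G_stretch[of "1 / c"] assms
    by (intro nn_integral_mono) (simp flip: ennreal_mult'')
  then show ?thesis by (simp add: nn_integral_cmult modular_def)
qed

lemma modular_G_cong_AE:
  assumes "AE x in lborel. v x = w x"
  shows "modular_G G v = modular_G G w"
  unfolding modular_G_def nn_integral_completion
  by (rule nn_integral_cong_AE) (use assms in eventually_elim, simp)

text \<open>Where \<open>v\<close> and \<open>w\<close> agree off a null set \<open>Z\<close>, the integrands agree for all \<open>(x, y)\<close> with \<open>x, y \<notin> Z\<close>,
  hence almost everywhere in the product. It permits passing to a Borel representative.\<close>

lemma modular_MNG_cong_AE: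
  fixes v w :: "real ^ 'n \<Rightarrow> real"
  assumes "AE x in lborel. v x = w x"
  shows "modular_MNG M N G v = modular_MNG M N G w"
proof -
  obtain Z where Z: "Z \<in> null_sets lborel" "{x. v x \<noteq> w x} \<subseteq> Z"
    using assms by (auto simp: eventually_ae_filter)
  have [measurable]: "Z \<in> sets borel" using Z by auto
  have ae: "AE x in lborel. x \<notin> Z" by (rule AE_not_in[OF Z(1)])
  have "AE z in lborel \<Otimes>\<^sub>M lborel. fst z \<notin> Z \<and> snd z \<notin> Z"
  proof (rule lborel_pair.AE_pair_measure)
    show "AE x in lborel. AE y in lborel. fst (x, y) \<notin> Z \<and> snd (x, y) \<notin> Z"
      using ae by eventually_elim (use ae in auto)
  qed measurable
  then have "AE (x, y) in lborel. v x = w x \<and> v y = w y"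
    unfolding lborel_prod by eventually_elim (use Z(2) in auto)
  then show ?thesis
    unfolding modular_MNG_def nn_integral_completion
    by (intro nn_integral_cong_AE) (auto elim!: eventually_mono)
qed

end

context nonlocal_energy
begin

lemma energy_uminus: "energy (\<lambda>x. - u x) = energy u"
proof -
  have "quotient (\<lambda>x. - u x) h = (\<lambda>x. - quotient u h x)" for h
    by (simp add: quotient_def fun_eq_iff minus_divide_left)
  then show ?thesis by (simp add: energy_def modular_uminus)
qed

lemma energy_divide_le:
  assumes [measurable]: "w \<in> borel_measurable borel" and c: "0 < c" "c \<le> 1"
  shows "energy (\<lambda>x. w x / c) \<le> ennreal ((1 / c) powr q) * energy w"
proof -
  have eq: "quotient (\<lambda>x. w x / c) h = (\<lambda>x. quotient w h x / c)" for h
    by (simp add: quotient_def fun_eq_iff diff_divide_distrib mult.commute)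
  have "energy (\<lambda>x. w x / c) \<le> (\<integral>\<^sup>+h. ennreal ((1 / c) powr q) * (weight h * modular (quotient w h)) \<partial>lborel)"
    unfolding energy_def eq
    by (intro nn_integral_mono)
      (metis modular_divide_le[OF measurable_quotient[OF assms(1)] c] mult.left_commute mult_left_mono zero_le)
  then show ?thesis by (simp add: nn_integral_cmult energy_def)
qed

text \<open>Averaging commutes with taking difference quotients, so this is \<open>modular_average_le\<close> for each \<open>h\<close>,
  integrated in \<open>h\<close>.\<close>

theorem energy_average_le:
  assumes \<rho>: "mollifier \<rho>" and [measurable]: "f \<in> borel_measurable borel"
    and int: "\<And>x. integrable lborel (\<lambda>z. \<rho> z * f (x + z))"
  shows "energy (\<lambda>x. f x - mollifier.average \<rho> f x)
    \<le> (\<integral>\<^sup>+z. ennreal (\<rho> z) * energy (\<lambda>x. f (x + z) - f x) \<partial>lborel)"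
proof -
  interpret mollifier \<rho> by fact
  have int_shift: "integrable lborel (\<lambda>z. \<rho> z * f (x + z + h))" for x h
    using int[of "x + h"] by (simp add: add_ac)
  have [measurable]: "(\<lambda>(z, h). modular (quotient (\<lambda>x. f (x + z) - f x) h)) \<in> borel_measurable (borel \<Otimes>\<^sub>M borel)"
    unfolding quotient_def by measurable
  have "energy (\<lambda>x. f x - average f x)
    \<le> (\<integral>\<^sup>+h. (\<integral>\<^sup>+z. weight h * (ennreal (\<rho> z) * modular (quotient (\<lambda>x. f (x + z) - f x) h)) \<partial>lborel) \<partial>lborel)"
    unfolding energy_def
  proof (rule nn_integral_mono)
    fix h :: 'a
    have eq1: "quotient (\<lambda>x. f x - average f x) h = (\<lambda>x. quotient f h x - average (quotient f h) x)"
    proof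
      fix x
      have "average (quotient f h) x = (\<integral>z. (\<rho> z * f (x + z) - \<rho> z * f (x + h + z)) / M (norm h) \<partial>lborel)"
        unfolding average_def quotient_def by (intro Bochner_Integration.integral_cong) (auto simp: algebra_simps)
      also have "\<dots> = (average f x - average f (x + h)) / M (norm h)"
        by (simp add: average_def int)
      finally have "average (quotient f h) x = (average f x - average f (x + h)) / M (norm h)" .
      then show "quotient (\<lambda>x. f x - average f x) h x = quotient f h x - average (quotient f h) x"
        by (simp only:) (simp add: quotient_def diff_divide_distrib)
    qed
    have eq2: "quotient (\<lambda>x. f (x + z) - f x) h = (\<lambda>x. quotient f h (x + z) - quotient f h x)" for z
      unfolding quotient_def diff_divide_distrib[symmetric] by (simp add: fun_eq_iff algebra_simps)
    have "integrable lborel (\<lambda>z. \<rho> z * quotient f h (x + z))" for x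
    proof -
      have "(\<lambda>z. \<rho> z * quotient f h (x + z)) = (\<lambda>z. (\<rho> z * f (x + z) - \<rho> z * f (x + z + h)) / M (norm h))"
        by (simp add: quotient_def fun_eq_iff algebra_simps)
      then show ?thesis by (simp add: int int_shift)
    qed
    from modular_average_le[OF \<rho> _ this]
    have "weight h * modular (quotient (\<lambda>x. f x - average f x) h)
      \<le> weight h * (\<integral>\<^sup>+z. ennreal (\<rho> z) * modular (quotient (\<lambda>x. f (x + z) - f x) h) \<partial>lborel)"
      unfolding eq1 eq2 by (intro mult_left_mono) auto
    then show "weight h * modular (quotient (\<lambda>x. f x - average f x) h)
      \<le> (\<integral>\<^sup>+z. weight h * (ennreal (\<rho> z) * modular (quotient (\<lambda>x. f (x + z) - f x) h)) \<partial>lborel)"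
      by (simp add: nn_integral_cmult)
  qed
  also have "\<dots> = (\<integral>\<^sup>+z. (\<integral>\<^sup>+h. weight h * (ennreal (\<rho> z) * modular (quotient (\<lambda>x. f (x + z) - f x) h)) \<partial>lborel) \<partial>lborel)"
    by (rule lborel_pair.Fubini') measurable
  also have "\<dots> = (\<integral>\<^sup>+z. ennreal (\<rho> z) * energy (\<lambda>x. f (x + z) - f x) \<partial>lborel)"
  proof (rule nn_integral_cong)
    fix z
    have "(\<integral>\<^sup>+h. weight h * (ennreal (\<rho> z) * modular (quotient (\<lambda>x. f (x + z) - f x) h)) \<partial>lborel)
      = (\<integral>\<^sup>+h. ennreal (\<rho> z) * (weight h * modular (quotient (\<lambda>x. f (x + z) - f x) h)) \<partial>lborel)"
      by (simp add: mult.left_commute)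
    then show "(\<integral>\<^sup>+h. weight h * (ennreal (\<rho> z) * modular (quotient (\<lambda>x. f (x + z) - f x) h)) \<partial>lborel)
      = ennreal (\<rho> z) * energy (\<lambda>x. f (x + z) - f x)"
      by (simp add: nn_integral_cmult energy_def)
  qed
  finally show ?thesis .
qed

end

section \<open>Density\<close>

context nonlocal_energy
begin

lemma nn_integral_pair_eq_energy:
  assumes [measurable]: "w \<in> borel_measurable borel"
  shows "(\<integral>\<^sup>+(x, y). ennreal (G ((w x - w y) / M (norm (x - y))) / N (norm (x - y))) \<partial>lborel) = energy w"
proof -
  let ?F = "\<lambda>x y. ennreal (G ((w x - w y) / M (norm (x - y))) / N (norm (x - y)))"
  have [measurable]: "(\<lambda>z::'a \<times> 'a. M (norm (fst z - snd z))) \<in> borel_measurable (borel \<Otimes>\<^sub>M borel)"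
    "(\<lambda>z::'a \<times> 'a. N (norm (fst z - snd z))) \<in> borel_measurable (borel \<Otimes>\<^sub>M borel)"
    using measurable_compose[of "\<lambda>z::'a \<times> 'a. fst z - snd z" "borel \<Otimes>\<^sub>M borel" borel, OF _ measurable_M]
      measurable_compose[of "\<lambda>z::'a \<times> 'a. fst z - snd z" "borel \<Otimes>\<^sub>M borel" borel, OF _ measurable_N] by auto
  have F [measurable]: "(\<lambda>(x, y). ?F x y) \<in> borel_measurable (borel \<Otimes>\<^sub>M borel)"
    unfolding split_beta' by measurable
  have section_F: "(\<lambda>y. ?F x y) \<in> borel_measurable borel" for x
    using measurable_Pair2[OF F, of x] by simp
  have "(\<integral>\<^sup>+(x, y). ?F x y \<partial>lborel) = (\<integral>\<^sup>+(x, y). ?F x y \<partial>(lborel \<Otimes>\<^sub>M lborel))"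
    by (simp add: lborel_prod)
  also have "\<dots> = (\<integral>\<^sup>+x. (\<integral>\<^sup>+y. ?F x y \<partial>lborel) \<partial>lborel)"
    by (subst lborel.nn_integral_fst[symmetric]) auto
  also have "\<dots> = (\<integral>\<^sup>+x. (\<integral>\<^sup>+h. ?F x (h + x) \<partial>lborel) \<partial>lborel)"
    by (rule nn_integral_cong) (rule nn_integral_translate[OF section_F, symmetric])
  also have "\<dots> = (\<integral>\<^sup>+x. (\<integral>\<^sup>+h. weight h * ennreal (G (quotient w h x)) \<partial>lborel) \<partial>lborel)"
    by (intro nn_integral_cong)
      (simp add: weight_def quotient_def add.commute N_nonneg flip: ennreal_mult'')
  also have "\<dots> = (\<integral>\<^sup>+h. (\<integral>\<^sup>+x. weight h * ennreal (G (quotient w h x)) \<partial>lborel) \<partial>lborel)"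
    by (rule lborel_pair.Fubini') measurable
  also have "\<dots> = energy w"
    by (simp add: nn_integral_cmult energy_def modular_def)
  finally show ?thesis .
qed

end

text \<open>The specialisation to \<open>real ^ 'n\<close>, where partial derivatives are defined; the type argument lets
  an interpretation select \<open>'n\<close>.\<close>

locale nonlocal_energy_cart = nonlocal_energy G p q M N "TYPE(real ^ 'n)"
  for G p q M N and index :: "'n::finite itself"
begin

lemma modular_G_eq: "modular_G G w = modular w" for w :: "real ^ 'n \<Rightarrow> real"
  by (simp add: modular_G_def nn_integral_completion modular_def)

lemma modular_MNG_eq:
  fixes w :: "real ^ 'n \<Rightarrow> real"
  assumes "w \<in> borel_measurable borel"
  shows "modular_MNG M N G w = energy w"
  using nn_integral_pair_eq_energy[OF assms] by (simp add: modular_MNG_def nn_integral_completion)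

text \<open>The upper growth exponent turns smallness of the modulars into smallness of the norms: dividing a
  function by \<open>c \<le> 1\<close> increases its modulars at most by the factor \<open>c powr - q\<close>.\<close>

lemma norm_MNG_le:
  fixes w :: "real ^ 'n \<Rightarrow> real"
  assumes [measurable]: "w \<in> borel_measurable borel" and c: "0 < c" "c \<le> 1"
    and small: "modular w \<le> ennreal (c powr q)" "energy w \<le> ennreal (c powr q)"
  shows "norm_MNG M N G w \<le> 2 * c"
proof -
  have one: "ennreal ((1 / c) powr q) * ennreal (c powr q) = 1"
    using c by (simp add: powr_divide flip: ennreal_mult)
  have "modular (\<lambda>x. w x / c) \<le> 1"
    using modular_divide_le[OF assms(1) c] mult_left_mono[OF small(1), of "ennreal ((1 / c) powr q)"]
    by (simp add: one)
  then have "norm_G G w \<le> c"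
    unfolding norm_G_def using c by (intro cInf_lower bdd_belowI[of _ 0]) (auto simp: modular_G_eq)
  moreover have "energy (\<lambda>x. w x / c) \<le> 1"
    using energy_divide_le[OF assms(1) c] mult_left_mono[OF small(2), of "ennreal ((1 / c) powr q)"]
    by (simp add: one)
  then have "seminorm_MNG M N G w \<le> c"
    unfolding seminorm_MNG_def using c
    by (intro cInf_lower bdd_belowI[of _ 0]) (auto simp: modular_MNG_eq)
  ultimately show ?thesis by (simp add: norm_MNG_def)
qed

lemma Cc_infinity_subset_W_space: "(Cc_infinity :: (real ^ 'n \<Rightarrow> real) set) \<subseteq> W_space M N G"
proof
  fix f :: "real ^ 'n \<Rightarrow> real" assume f: "f \<in> Cc_infinity"
  note [measurable] = Cc_infinity_measurable[OF f]
  obtain R where R: "\<And>x. R < norm x \<Longrightarrow> f x = 0" using Cc_infinity_support[OF f] by blast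
  obtain B where B: "0 \<le> B" "\<And>x. \<bar>f x\<bar> \<le> B" using Cc_infinity_bounded[OF f] by blast
  obtain L where L: "0 \<le> L" "\<And>x y. \<bar>f x - f y\<bar> \<le> L * norm (x - y)"
    using Cc_infinity_Lipschitz[OF f] by metis
  have "\<bar>f x - f (x + h)\<bar> \<le> max L (2 * B) * min 1 (norm h)" for x h
  proof (cases "norm h \<le> 1")
    case True
    have "\<bar>f x - f (x + h)\<bar> \<le> L * norm h" using L(2)[of x "x + h"] by simp
    also have "\<dots> \<le> max L (2 * B) * norm h" by (intro mult_right_mono) auto
    finally show ?thesis using True by simp
  next
    case False
    have "\<bar>f x - f (x + h)\<bar> \<le> 2 * B" using B(2)[of x] B(2)[of "x + h"] by linarith
    then show ?thesis using False by simp
  qed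
  then have "energy f < \<infinity>"
    by (intro energy_finite_bounded_Lipschitz[OF _ _ R]) auto
  moreover have "modular f < \<infinity>"
    by (rule modular_bounded_support_finite[OF B(2) R])
  moreover have "f \<in> borel_measurable lebesgue"
    by (intro measurable_completion) simp
  ultimately show "f \<in> W_space M N G"
    by (simp add: W_space_def L_space_def modular_G_eq modular_MNG_eq)
qed

text \<open>Mollification at a scale at which translations move \<open>v\<close> by little in both modulars.\<close>

theorem approximation_compact_support:
  fixes v :: "real ^ 'n \<Rightarrow> real"
  assumes [measurable]: "v \<in> borel_measurable borel"
    and fin: "modular v < \<infinity>" "energy v < \<infinity>" and supp: "\<And>x. R < norm x \<Longrightarrow> v x = 0" and "0 < e"
  obtains \<phi> where "\<phi> \<in> Cc_infinity" "modular (\<lambda>x. v x - \<phi> x) \<le> ennreal e" "energy (\<lambda>x. v x - \<phi> x) \<le> ennreal e"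
proof -
  obtain d1 where d1: "0 < d1" "\<And>z. norm z < d1 \<Longrightarrow> modular (\<lambda>x. v (x + z) - v x) \<le> ennreal e"
    using small_near_0[of "\<lambda>z. modular (\<lambda>x. v (x + z) - v x)",
        OF modular_translation_continuous[OF assms(1) fin(1)] \<open>0 < e\<close>] by blast
  obtain d2 where d2: "0 < d2" "\<And>z. norm z < d2 \<Longrightarrow> energy (\<lambda>x. v (x + z) - v x) \<le> ennreal e"
    using small_near_0[of "\<lambda>z. energy (\<lambda>x. v (x + z) - v x)",
        OF energy_translation_continuous[OF assms(1) fin(2)] \<open>0 < e\<close>] by blast
  obtain \<rho> :: "real ^ 'n \<Rightarrow> real" where \<rho>: "\<rho> \<in> Cc_infinity" "\<And>x. 0 \<le> \<rho> x" "\<And>x. \<rho> (- x) = \<rho> x"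
    "\<And>x. min d1 d2 \<le> norm x \<Longrightarrow> \<rho> x = 0" "(\<integral>\<^sup>+x. ennreal (\<rho> x) \<partial>lborel) = 1"
    using mollifier_exists[of "min d1 d2"] d1(1) d2(1) by auto
  note [measurable] = Cc_infinity_measurable[OF \<rho>(1)]
  have m: "mollifier \<rho>" by unfold_locales (use \<rho> in auto)
  interpret mollifier \<rho> by (rule m)
  have int_v: "integrable lborel v" by (rule integrable_bounded_support[OF assms(1) fin(1) supp])
  obtain B where B: "\<And>x. \<bar>\<rho> x\<bar> \<le> B" using Cc_infinity_bounded[OF \<rho>(1)] by blast
  have int: "integrable lborel (\<lambda>z. \<rho> z * v (x + z))" for x
    by (rule integrable_bounded_mult[OF _ _ B]) (auto simp: lborel_integrable_translate int_v)
  have avg: "average v = convolution \<rho> v"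
  proof
    fix x
    have "average v x = (\<integral>z. \<rho> (x - (x + z)) * v (x + z) \<partial>lborel)"
      by (simp add: average_def \<rho>(3))
    also have "\<dots> = convolution \<rho> v x"
      unfolding convolution_def by (rule lborel_integral_translate) measurable
    finally show "average v x = convolution \<rho> v x" .
  qed
  have near: "norm z < d1" "norm z < d2" if "\<rho> z \<noteq> 0" for z
    using \<rho>(4)[of z] that by linarith+
  show ?thesis
  proof (rule that[of "average v"])
    show "average v \<in> Cc_infinity"
      unfolding avg by (rule convolution_Cc_infinity[OF \<rho>(1) int_v supp])
    show "modular (\<lambda>x. v x - average v x) \<le> ennreal e"
      by (rule order_trans[OF modular_average_le[OF m assms(1) int] nn_integral_mollifier_le])
        (use d1(2) near in auto)
    show "energy (\<lambda>x. v x - average v x) \<le> ennreal e"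
      by (rule order_trans[OF energy_average_le[OF m assms(1) int] nn_integral_mollifier_le])
        (use d2(2) near in auto)
  qed
qed

text \<open>Cut off a Borel representative of \<open>u\<close>, then mollify.\<close>

theorem Cc_infinity_dense:
  fixes u :: "real ^ 'n \<Rightarrow> real"
  assumes u: "u \<in> W_space M N G" and "0 < \<epsilon>"
  obtains \<phi> where "\<phi> \<in> Cc_infinity" "norm_MNG M N G (\<lambda>x. u x - \<phi> x) < \<epsilon>"
proof -
  define c where "c = min 1 (\<epsilon> / 3)"
  have c: "0 < c" "c \<le> 1" "2 * c < \<epsilon>" using \<open>0 < \<epsilon>\<close> by (auto simp: c_def min_def)
  \<comment> \<open>The two errors, of the cutoff and of the mollification, add up to at most \<open>\<Delta> * (e + e)\<close>.\<close>
  define e where "e = c powr q / (2 * \<Delta>)"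
  have e: "0 < e" "\<Delta> * (e + e) = c powr q"
    using c Delta_ge_1 by (auto simp: e_def)
  have "u \<in> borel_measurable lebesgue"
    using u by (simp add: W_space_def L_space_def)
  from completion_ex_borel_measurable_real[OF this] obtain u' where [measurable]: "u' \<in> borel_measurable borel" and ae: "AE x in lborel. u x = u' x"
    by auto
  have fin: "modular u' < \<infinity>" "energy u' < \<infinity>"
    using u modular_G_cong_AE[OF ae] modular_MNG_cong_AE[OF ae, of M N]
    by (simp_all add: W_space_def L_space_def modular_G_eq modular_MNG_eq)
  let ?r = "\<lambda>k x. u' x - cutoff k x * u' x"
  have "eventually (\<lambda>k. modular (?r k) < ennreal e \<and> energy (?r k) < ennreal e) sequentially"
    using eventually_less_ennreal[OF modular_cutoff[OF _ fin(1)] e(1)]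
      eventually_less_ennreal[OF energy_cutoff[OF _ fin] e(1)]
    by (simp add: eventually_conj_iff)
  from eventually_happens[OF this] obtain k where k: "modular (?r k) < ennreal e" "energy (?r k) < ennreal e"
    by auto
  define v where "v x = cutoff k x * u' x" for x
  have [measurable]: "v \<in> borel_measurable borel" unfolding v_def by measurable
  have "modular v \<le> modular u'"
  proof (rule modular_mono)
    fix x have "\<bar>cutoff k x\<bar> * \<bar>u' x\<bar> \<le> 1 * \<bar>u' x\<bar>"
      using cutoff_bounds[of k x] by (intro mult_right_mono) auto
    then show "\<bar>v x\<bar> \<le> \<bar>u' x\<bar>" by (simp add: v_def abs_mult)
  qed
  with fin(1) have v1: "modular v < \<infinity>" by simp
  have "energy v = energy (\<lambda>x. u' x + - ?r k x)" by (simp add: v_def[abs_def])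
  also have "\<dots> \<le> ennreal \<Delta> * (energy u' + energy (\<lambda>x. - ?r k x))"
    by (rule energy_add) measurable
  also have "\<dots> < \<infinity>"
    unfolding energy_uminus using fin(2) order_less_trans[OF k(2) ennreal_less_top]
    by (simp add: ennreal_mult_less_top)
  finally have v2: "energy v < \<infinity>" .
  have v3: "2 * (real k + 1) < norm x \<Longrightarrow> v x = 0" for x
    by (simp add: v_def cutoff_eq_0)
  obtain \<phi> where \<phi>: "\<phi> \<in> Cc_infinity" "modular (\<lambda>x. v x - \<phi> x) \<le> ennreal e" "energy (\<lambda>x. v x - \<phi> x) \<le> ennreal e"
    using approximation_compact_support[OF _ v1 v2 v3 e(1)] by auto
  note [measurable] = Cc_infinity_measurable[OF \<phi>(1)]
  let ?w = "\<lambda>x. u' x - \<phi> x"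
  have w: "?w = (\<lambda>x. ?r k x + (v x - \<phi> x))" by (simp add: v_def)
  have sum: "ennreal \<Delta> * (a + b) \<le> ennreal (c powr q)" if "a \<le> ennreal e" "b \<le> ennreal e" for a b
  proof -
    have "ennreal \<Delta> * (a + b) \<le> ennreal \<Delta> * (ennreal e + ennreal e)"
      by (intro mult_left_mono add_mono that) auto
    also have "\<dots> = ennreal (c powr q)"
      using e Delta_ge_1 by (simp flip: ennreal_plus ennreal_mult)
    finally show ?thesis .
  qed
  have "modular ?w \<le> ennreal (c powr q)"
    unfolding w by (rule order_trans[OF modular_add sum]) (use k(1) \<phi>(2) in auto)
  moreover have "energy ?w \<le> ennreal (c powr q)"
    unfolding w by (rule order_trans[OF energy_add sum]) (use k(2) \<phi>(3) in auto)
  ultimately have "norm_MNG M N G ?w \<le> 2 * c"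
    by (intro norm_MNG_le c) auto
  also have "norm_MNG M N G ?w = norm_MNG M N G (\<lambda>x. u x - \<phi> x)"
  proof -
    have ae': "AE x in lborel. (u' x - \<phi> x) / t = (u x - \<phi> x) / t" for t
      using ae by eventually_elim simp
    show ?thesis
      unfolding norm_MNG_def norm_G_def seminorm_MNG_def
      using modular_G_cong_AE[OF ae'] modular_MNG_cong_AE[OF ae', of M N] by simp
  qed
  finally show ?thesis using \<phi>(1) c(3) that by auto
qed

end

theorem proposition2p9:
  fixes G M N :: "real \<Rightarrow> real" and p q :: real
  assumes "young_function G"
    and "growth p q G"
    and "\<And>r. r \<ge> 0 \<Longrightarrow> M r \<ge> 0" and "\<And>r. r \<ge> 0 \<Longrightarrow> N r \<ge> 0"
    and "cond_M1 M N" and "cond_M2 M N"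
    and "cond_M3 CARD('n::finite) p M N"
  shows "(Cc_infinity :: (real ^ 'n \<Rightarrow> real) set) \<subseteq> W_space M N G \<and>
    (\<forall>u \<in> (W_space M N G :: (real ^ 'n \<Rightarrow> real) set). \<forall>\<epsilon>>0.
       \<exists>\<phi> \<in> Cc_infinity. norm_MNG M N G (\<lambda>x. u x - \<phi> x) < \<epsilon>)"
proof -
  interpret nonlocal_energy_cart G p q M N "TYPE('n)"
    by unfold_locales (use assms in auto)
  show ?thesis
    using Cc_infinity_subset_W_space by (auto elim!: Cc_infinity_dense)
qed

end
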